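(* Let $(\mathcal{L}^*,\mathcal{I}^*,k,X,\bar{Y})$ be a quintuple satisfying the $n$-variable theorem (in the sense defined in the context), and let $D=D^{\mathcal{L}^*,\mathcal{I}^*}_{k,X,\bar{Y}}\in\mathfrak{D}^h_{n\text{-var}}$. Let $\mathcal{L}$ be a language, $T$ a complete $\mathcal{L}$-theory, and $\mathbb{M}\models T$ a sufficiently saturated model. If $T\notin D$, then there exist an $\mathcal{L}$-formula $\varphi(\bar{x},\bar{y})=\varphi(\bar{x},y_0,\dots,y_{k-1})$ and an $\mathcal{I}^*_{\mathcal{L}^*}$-indiscernible $(a_\eta)_{\eta\in\mathcal{I}^*}$ in $\mathbb{M}$ with $|y_0|=\cdots=|y_{k-1}|=|a_\eta|$ for all $\eta\in\mathcal{I}^*$ such that (i) $\varphi(\bar{x},\bar{y})$ witnesses $T\notin D$ with $(a_\eta)_{\eta\in\mathcal{I}^*}$, i.e. $\{\varphi(\bar{x},\bar{a}_{\bar\eta})\}_{\bar\eta\in X}$ is consistent and $\{\varphi(\bar{x},\bar{a}_{\bar\nu})\}_{\bar\nu\in Y}$ is inconsistent for each $Y\in\bar{Y}$; (ii) there exists $\bar{b}\models\{\varphi(\bar{x},\bar{a}_{\bar\eta})\}_{\bar\eta\in X}$ such that $\dim(\bar{b}/(a_\eta)_{\eta\in\mathcal{I}^*})=|\bar{x}|$.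
   Context: Notation. $|x|$ is the length of a tuple $x$. Let $\mathcal{L}^*$ be a language, $\mathcal{I}^*$ an $\mathcal{L}^*$-structure, $k$ a natural number. For tuples $\bar\eta,\bar\nu$ from $\mathcal{I}^*$ of the same length, $\bar\eta\sim\bar\nu$ means they have the same quantifier-free $\mathcal{L}^*$-type in $\mathcal{I}^*$. For sets $S,S'\subseteq(\mathcal{I}^* )^k$ of $k$-tuples, $S\sim S'$ means $S,S'$ have enumerations $(s_i)_i,(s'_i)_i$ whose concatenations have the same quantifier-free type; $S\sim^{\mathrm{fin}}S'$ means every finite $S_0\subseteq S$ satisfies $S_0\sim S_0'$ for some $S_0'\subseteq S'$ and every finite $S_0'\subseteq S'$ satisfies $S'_0\sim S_0$ for some $S_0\subseteq S$. $\langle\bar\eta\rangle$ is the substructure generated by $\bar\eta$, and $\langle\bar\eta\rangle\sim\langle\bar\nu\rangle$ means there is an isomorphism $\langle\bar\eta\rangle\to\langle\bar\nu\rangle$ sending $\bar\eta$ to $\bar\nu$ coordinatewise. $\mathrm{age}(\mathcal{I}^* )$ is the class of $\mathcal{L}^*$-structures isomorphic to a finitely generated substructure of $\mathcal{I}^*$. For an $\mathcal{I}^*$-indexed $(a_\eta)_{\eta\in\mathcal{I}^*}$ and $\bar\eta=(\eta_0,\dots,\eta_{k-1})$, $\bar{a}_{\bar\eta}:=(a_{\eta_0},\dots,a_{\eta_{k-1}})$. Generalized indiscernibles. Let $\mathbb{M}$ be a sufficiently saturated $\mathcal{L}$-structure, $A\subseteq\mathbb{M}$ small, and $(a_\eta)_{\eta\in\mathcal{I}^*}$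 tuples of $\mathbb{M}$ of the same length. $(a_\eta)$ is $\mathcal{I}^*_{\mathcal{L}^*}$-indiscernible over $A$ if $\bar\eta\sim\bar\nu$ implies $\mathrm{tp}_{\mathcal{L}}((a_{\eta_i})_i/A)=\mathrm{tp}_{\mathcal{L}}((a_{\nu_i})_i/A)$. $\mathcal{I}^*$ has the modeling property if for every language $\mathcal{L}$, every $\mathcal{L}$-theory with monster model $\mathbb{M}$, small $A\subseteq\mathbb{M}$, and $(a_\eta)_{\eta\in\mathcal{I}^*}$ in $\mathbb{M}$ of the same length, there is $(b_\eta)_{\eta\in\mathcal{I}^*}$ in $\mathbb{M}$ which is $\mathcal{I}^*_{\mathcal{L}^*}$-indiscernible over $A$ and such that for every finite tuple $\bar\eta$ of $\mathcal{I}^*$ and $\varphi\in\mathrm{tp}((b_{\eta_i})_i/A)$ there is $\bar\nu\sim\bar\eta$ with $\mathbb{M}\models\varphi((a_{\nu_i})_i)$. Conditions on index structures. $\mathcal{I}^*$ is $k$-weakly monochromatic if the substructures $\langle\bar\eta\rangle$ generated by $k$-tuples fall into finitely many isomorphism types. For $J\subseteq(\mathcal{I}^* )^k$, $\mathcal{I}^*$ is $k$-monochromatically extendable over $J$ if for every cardinal $\lambda$ there is $\mathcal{I}^\dagger$ with $\mathrm{age}(\mathcal{I}^\dagger)=\mathrm{age}(\mathcal{I}^* )$ such that for every $c:(\mathcal{I}^\dagger)^k\to\lambda$ there is an $\mathcal{L}^*$-embedding $f:\mathcal{I}^*\to\mathcal{I}^\dagger$ with $c(f(\bar\eta))=c(f(\bar\nu))$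 whenever $\bar\eta,\bar\nu\in J$ and $\langle\bar\eta\rangle\sim\langle\bar\nu\rangle$. $X\subseteq(\mathcal{I}^* )^k$ is cofinal in $\mathcal{I}^*$ if for every finite $Z\subseteq\mathcal{I}^*$ there is an $\mathcal{L}^*$-embedding $f:\mathcal{I}^*\to\mathcal{I}^*$ such that $f(\mathcal{I}^* )\cap Z=\emptyset$; for all finite tuples $\bar\eta,\bar\nu$ of the same length in $f(\mathcal{I}^* )$, $\bar\eta\sim\bar\nu$ implies $\bar\eta Z\sim\bar\nu Z$ ($Z$ enumerated in a fixed way); and $f(\mathcal{I}^* )^k\cap X\sim^{\mathrm{fin}}X$. A quintuple $(\mathcal{L}^*,\mathcal{I}^*,k,X,\bar{Y})$, with $X\subseteq(\mathcal{I}^* )^k$ and $\bar{Y}$ a finite set of subsets of $(\mathcal{I}^* )^k$, "satisfies the $n$-variable theorem" if: (i) $\mathcal{I}^*$ has the modeling property; (ii) $\mathcal{I}^*$ is $k$-weakly monochromatic; (iii) $X$ is cofinal in $\mathcal{I}^*$; (iv) $\mathcal{I}^*$ is $k$-monochromatically extendable over $\mathbb{X}:=\{\bar\eta\in(\mathcal{I}^* )^k:\langle\bar\eta\rangle\sim\langle\bar\nu\rangle\text{ for some }\bar\nu\in X\}$; (v) $Y\subseteq\mathbb{X}$ for each $Y\in\bar{Y}$; (vi) $|Y|>1$ for each $Y\in\bar{Y}$; (vii) there is a disjoint union $W\subseteq(\mathcal{I}^* )^k$ of sets $X',Y'$ such that $X'\sim^{\mathrm{fin}}X$, $Y'\sim^{\mathrm{fin}}Y$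 for some $Y\in\bar{Y}$, and $\{\nu\}\cup X'\sim^{\mathrm{fin}}X$ for each $\nu\in Y'$. For such a quintuple, $D^{\mathcal{L}^*,\mathcal{I}^*}_{k,X,\bar{Y}}$ is the class of complete theories $T$ for which there do not exist a formula $\varphi(x,y_0,\dots,y_{k-1})$ in the language of $T$ and an $\mathcal{I}^*_{\mathcal{L}^*}$-indiscernible $(a_\eta)_{\eta\in\mathcal{I}^*}$ in a model of $T$ such that $\{\varphi(x,\bar{a}_{\bar\eta})\}_{\bar\eta\in X}$ is consistent and $\{\varphi(x,\bar{a}_{\bar\nu})\}_{\bar\nu\in Y}$ is inconsistent for each $Y\in\bar{Y}$. $\mathfrak{D}^h_{n\text{-var}}$ is the class of all such $D^{\mathcal{L}^*,\mathcal{I}^*}_{k,X,\bar{Y}}$. (The "$n$" is only part of the name.) Algebraic dimension. A set $B$ of elements of $\mathbb{M}$ is algebraically independent over $A$ if $b\notin\mathrm{acl}(A\cup(B\setminus\{b\}))$ for all $b\in B$. For $\bar{b}=(b_0,\dots,b_{m-1})\in\mathbb{M}^m$, $\dim(\bar{b}/A)$ is the maximum of $|B|$ over subsets $B\subseteq\{b_0,\dots,b_{m-1}\}$ algebraically independent over $A$. *)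

theory Defs
  imports "HOL-Library.FuncSet"
begin

unbundle cardinal_syntax

section \<open>First-order languages, structures and formulas\<close>

record ('f, 'r) language =
  funs :: "'f set"
  rels :: "'r set"
  farity :: "'f \<Rightarrow> nat"
  rarity :: "'r \<Rightarrow> nat"

text \<open>Only the values of the interpretations on the carrier, for symbols of the language at hand
  and argument lists of the right length, are meaningful.\<close>

record ('f, 'r, 'm) struct =
  carrier :: "'m set"
  fint :: "'f \<Rightarrow> 'm list \<Rightarrow> 'm"
  rint :: "'r \<Rightarrow> 'm list \<Rightarrow> bool"

datatype 'f tm = Var nat | App 'f "'f tm list"

datatype ('f, 'r) fm =
    Falsum
  | Equal "'f tm" "'f tm"
  | Atom 'r "'f tm list"
  | Neg "('f, 'r) fm"
  | Conj "('f, 'r) fm" "('f, 'r) fm"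
  | Exists nat "('f, 'r) fm"

definition is_structure :: "('f, 'r) language \<Rightarrow> ('f, 'r, 'm) struct \<Rightarrow> bool" where
  "is_structure L M \<longleftrightarrow> carrier M \<noteq> {} \<and>
    (\<forall>f\<in>funs L. \<forall>xs\<in>lists (carrier M). length xs = farity L f \<longrightarrow> fint M f xs \<in> carrier M)"

fun wf_tm :: "('f, 'r) language \<Rightarrow> 'f tm \<Rightarrow> bool" where
  "wf_tm L (Var i) = True"
| "wf_tm L (App f ts) = (f \<in> funs L \<and> length ts = farity L f \<and> (\<forall>t\<in>set ts. wf_tm L t))"

fun wf_fm :: "('f, 'r) language \<Rightarrow> ('f, 'r) fm \<Rightarrow> bool" where
  "wf_fm L Falsum = True"
| "wf_fm L (Equal s t) = (wf_tm L s \<and> wf_tm L t)"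
| "wf_fm L (Atom r ts) = (r \<in> rels L \<and> length ts = rarity L r \<and> (\<forall>t\<in>set ts. wf_tm L t))"
| "wf_fm L (Neg \<phi>) = wf_fm L \<phi>"
| "wf_fm L (Conj \<phi> \<psi>) = (wf_fm L \<phi> \<and> wf_fm L \<psi>)"
| "wf_fm L (Exists i \<phi>) = wf_fm L \<phi>"

fun fv_tm :: "'f tm \<Rightarrow> nat set" where
  "fv_tm (Var i) = {i}"
| "fv_tm (App f ts) = (\<Union>t\<in>set ts. fv_tm t)"

fun fv :: "('f, 'r) fm \<Rightarrow> nat set" where
  "fv Falsum = {}"
| "fv (Equal s t) = fv_tm s \<union> fv_tm t"
| "fv (Atom r ts) = (\<Union>t\<in>set ts. fv_tm t)"
| "fv (Neg \<phi>) = fv \<phi>"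
| "fv (Conj \<phi> \<psi>) = fv \<phi> \<union> fv \<psi>"
| "fv (Exists i \<phi>) = fv \<phi> - {i}"

fun qfree :: "('f, 'r) fm \<Rightarrow> bool" where
  "qfree (Neg \<phi>) = qfree \<phi>"
| "qfree (Conj \<phi> \<psi>) = (qfree \<phi> \<and> qfree \<psi>)"
| "qfree (Exists i \<phi>) = False"
| "qfree _ = True"

fun eval_tm :: "('f, 'r, 'm) struct \<Rightarrow> (nat \<Rightarrow> 'm) \<Rightarrow> 'f tm \<Rightarrow> 'm" where
  "eval_tm M e (Var i) = e i"
| "eval_tm M e (App f ts) = fint M f (map (eval_tm M e) ts)"

fun sat :: "('f, 'r, 'm) struct \<Rightarrow> (nat \<Rightarrow> 'm) \<Rightarrow> ('f, 'r) fm \<Rightarrow> bool" where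
  "sat M e Falsum = False"
| "sat M e (Equal s t) = (eval_tm M e s = eval_tm M e t)"
| "sat M e (Atom r ts) = rint M r (map (eval_tm M e) ts)"
| "sat M e (Neg \<phi>) = (\<not> sat M e \<phi>)"
| "sat M e (Conj \<phi> \<psi>) = (sat M e \<phi> \<and> sat M e \<psi>)"
| "sat M e (Exists i \<phi>) = (\<exists>a\<in>carrier M. sat M (e(i := a)) \<phi>)"

text \<open>\<open>formulas L m\<close>: the \<open>L\<close>-formulas in the free variables \<open>0, \<dots>, m - 1\<close>.  Such a formula is
  evaluated at a tuple of length \<open>m\<close>, entry \<open>i\<close> being the value of variable \<open>i\<close>.  An \<open>L(A)\<close>-formula
  is a pair of an \<open>L\<close>-formula and a list of parameters from \<open>A\<close>, the parameters being substituted
  for the last variables.\<close>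

definition formulas :: "('f, 'r) language \<Rightarrow> nat \<Rightarrow> ('f, 'r) fm set" where
  "formulas L m = {\<phi>. wf_fm L \<phi> \<and> fv \<phi> \<subseteq> {..<m}}"

definition holds :: "('f, 'r, 'm) struct \<Rightarrow> ('f, 'r) fm \<Rightarrow> 'm list \<Rightarrow> bool" where
  "holds M \<phi> xs \<longleftrightarrow> sat M ((!) xs) \<phi>"

definition models :: "('f, 'r, 'm) struct \<Rightarrow> ('f, 'r) fm set \<Rightarrow> bool" where
  "models M T \<longleftrightarrow> (\<forall>\<sigma>\<in>T. holds M \<sigma> [])"

text \<open>By the downward Loewenheim-Skolem theorem it suffices, for satisfiability and consequence,
  to consider the structures whose carrier is a set of elements of the (large enough) type of
  formulas.\<close>

definition satisfiable :: "('f, 'r) language \<Rightarrow> ('f, 'r) fm set \<Rightarrow> bool" where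
  "satisfiable L T \<longleftrightarrow> (\<exists>N :: ('f, 'r, ('f, 'r) fm) struct. is_structure L N \<and> models N T)"

definition entails :: "('f, 'r) language \<Rightarrow> ('f, 'r) fm set \<Rightarrow> ('f, 'r) fm \<Rightarrow> bool" where
  "entails L T \<sigma> \<longleftrightarrow>
    (\<forall>N :: ('f, 'r, ('f, 'r) fm) struct. is_structure L N \<longrightarrow> models N T \<longrightarrow> holds N \<sigma> [])"

definition complete_theory :: "('f, 'r) language \<Rightarrow> ('f, 'r) fm set \<Rightarrow> bool" where
  "complete_theory L T \<longleftrightarrow> T \<subseteq> formulas L 0 \<and> satisfiable L T \<and>
    (\<forall>\<sigma>\<in>formulas L 0. entails L T \<sigma> \<or> entails L T (Neg \<sigma>))"


section \<open>Types, saturation, algebraic dimension\<close>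

text \<open>\<open>tp L M A D c\<close> is the complete type over \<open>A\<close> of the possibly infinite tuple \<open>(c d)\<close>, \<open>d \<in> D\<close>:
  the formula \<open>\<phi>\<close> is applied to finitely many coordinates \<open>ds\<close> and parameters \<open>ps\<close>.\<close>

definition tp :: "('f, 'r) language \<Rightarrow> ('f, 'r, 'm) struct \<Rightarrow> 'm set \<Rightarrow> 'd set \<Rightarrow> ('d \<Rightarrow> 'm)
    \<Rightarrow> (('f, 'r) fm \<times> 'd list \<times> 'm list) set" where
  "tp L M A D c = {(\<phi>, ds, ps). ds \<in> lists D \<and> ps \<in> lists A \<and>
     \<phi> \<in> formulas L (length ds + length ps) \<and> holds M \<phi> (map c ds @ ps)}"

definition saturated :: "'k rel \<Rightarrow> ('f, 'r) language \<Rightarrow> ('f, 'r, 'm) struct \<Rightarrow> bool" where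
  "saturated \<kappa> L M \<longleftrightarrow>
    (\<forall>A p. A \<subseteq> carrier M \<longrightarrow> |A| <o \<kappa> \<longrightarrow>
       p \<subseteq> {(\<phi>, ps). ps \<in> lists A \<and> \<phi> \<in> formulas L (1 + length ps)} \<longrightarrow>
       (\<forall>q\<subseteq>p. finite q \<longrightarrow> (\<exists>b\<in>carrier M. \<forall>(\<phi>, ps)\<in>q. holds M \<phi> (b # ps))) \<longrightarrow>
       (\<exists>b\<in>carrier M. \<forall>(\<phi>, ps)\<in>p. holds M \<phi> (b # ps)))"

text \<open>``Sufficiently saturated'', relative to the index structure \<open>I\<close>: \<open>\<kappa>\<close>-saturated for a cardinal
  \<open>\<kappa>\<close> above \<open>|L| + |I| + \<aleph>\<^sub>0\<close>.  Small then means of cardinality less than \<open>\<kappa>\<close>.\<close>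

definition sufficiently_saturated ::
    "'k rel \<Rightarrow> ('lf, 'lr, 'i) struct \<Rightarrow> ('f, 'r) language \<Rightarrow> ('f, 'r, 'm) struct \<Rightarrow> bool" where
  "sufficiently_saturated \<kappa> I L M \<longleftrightarrow>
     Card_order \<kappa> \<and> natLeq <o \<kappa> \<and> |funs L| <o \<kappa> \<and> |rels L| <o \<kappa> \<and> |carrier I| <o \<kappa> \<and>
     saturated \<kappa> L M"

definition acl :: "('f, 'r) language \<Rightarrow> ('f, 'r, 'm) struct \<Rightarrow> 'm set \<Rightarrow> 'm set" where
  "acl L M A = {b \<in> carrier M. \<exists>\<phi> ps. ps \<in> lists A \<and> \<phi> \<in> formulas L (1 + length ps) \<and>
     holds M \<phi> (b # ps) \<and> finite {c \<in> carrier M. holds M \<phi> (c # ps)}}"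

definition alg_independent ::
    "('f, 'r) language \<Rightarrow> ('f, 'r, 'm) struct \<Rightarrow> 'm set \<Rightarrow> 'm set \<Rightarrow> bool" where
  "alg_independent L M A B \<longleftrightarrow> (\<forall>b\<in>B. b \<notin> acl L M (A \<union> (B - {b})))"

definition alg_dim :: "('f, 'r) language \<Rightarrow> ('f, 'r, 'm) struct \<Rightarrow> 'm list \<Rightarrow> 'm set \<Rightarrow> nat" where
  "alg_dim L M b A = Max (card ` {B. B \<subseteq> set b \<and> alg_independent L M A B})"


section \<open>Substructures, embeddings and quantifier-free types in index structures\<close>

definition tuples :: "nat \<Rightarrow> 'a set \<Rightarrow> 'a list set" where
  "tuples k A = {\<eta> \<in> lists A. length \<eta> = k}"

definition embedding :: "('f, 'r) language \<Rightarrow> ('f, 'r, 'a) struct \<Rightarrow> ('f, 'r, 'b) struct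
    \<Rightarrow> ('a \<Rightarrow> 'b) \<Rightarrow> bool" where
  "embedding L M N h \<longleftrightarrow> h ` carrier M \<subseteq> carrier N \<and> inj_on h (carrier M) \<and>
    (\<forall>f\<in>funs L. \<forall>xs\<in>tuples (farity L f) (carrier M). h (fint M f xs) = fint N f (map h xs)) \<and>
    (\<forall>r\<in>rels L. \<forall>xs\<in>tuples (rarity L r) (carrier M). rint M r xs \<longleftrightarrow> rint N r (map h xs))"

definition isomorphism :: "('f, 'r) language \<Rightarrow> ('f, 'r, 'a) struct \<Rightarrow> ('f, 'r, 'b) struct
    \<Rightarrow> ('a \<Rightarrow> 'b) \<Rightarrow> bool" where
  "isomorphism L M N h \<longleftrightarrow> embedding L M N h \<and> h ` carrier M = carrier N"

inductive_set gen_closure :: "('f, 'r) language \<Rightarrow> ('f, 'r, 'm) struct \<Rightarrow> 'm set \<Rightarrow> 'm set"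
  for L :: "('f, 'r) language" and M :: "('f, 'r, 'm) struct" and S :: "'m set" where
  base: "x \<in> S \<Longrightarrow> x \<in> gen_closure L M S"
| step: "f \<in> funs L \<Longrightarrow> length xs = farity L f \<Longrightarrow> \<forall>x\<in>set xs. x \<in> gen_closure L M S
         \<Longrightarrow> fint M f xs \<in> gen_closure L M S"

definition generated :: "('f, 'r) language \<Rightarrow> ('f, 'r, 'm) struct \<Rightarrow> 'm list \<Rightarrow> ('f, 'r, 'm) struct"
  where "generated L M \<eta> = M\<lparr>carrier := gen_closure L M (set \<eta>)\<rparr>"

definition isomorphic_over :: "('f, 'r) language \<Rightarrow> ('f, 'r, 'm) struct \<Rightarrow> 'm list \<Rightarrow> 'm list \<Rightarrow> bool"
  where "isomorphic_over L M \<eta> \<nu> \<longleftrightarrow>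
    (\<exists>h. isomorphism L (generated L M \<eta>) (generated L M \<nu>) h \<and> map h \<eta> = \<nu>)"

text \<open>The members of the age of \<open>M\<close> whose elements come from the type \<open>'w\<close>.\<close>

definition age :: "('f, 'r) language \<Rightarrow> ('f, 'r, 'm) struct \<Rightarrow> ('f, 'r, 'w) struct set" where
  "age L M = {N. is_structure L N \<and>
     (\<exists>\<eta>\<in>lists (carrier M). \<exists>h. isomorphism L N (generated L M \<eta>) h)}"

definition qftp :: "('f, 'r) language \<Rightarrow> ('f, 'r, 'm) struct \<Rightarrow> 'm list \<Rightarrow> ('f, 'r) fm set" where
  "qftp L M \<eta> = {\<phi> \<in> formulas L (length \<eta>). qfree \<phi> \<and> holds M \<phi> \<eta>}"

definition sim :: "('f, 'r) language \<Rightarrow> ('f, 'r, 'm) struct \<Rightarrow> 'm list \<Rightarrow> 'm list \<Rightarrow> bool" where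
  "sim L M \<eta> \<nu> \<longleftrightarrow> length \<eta> = length \<nu> \<and> qftp L M \<eta> = qftp L M \<nu>"

text \<open>Enumerations are lists because \<open>sim_sets\<close> is only needed for finite sets of \<open>k\<close>-tuples.\<close>

definition sim_sets ::
    "('f, 'r) language \<Rightarrow> ('f, 'r, 'm) struct \<Rightarrow> 'm list set \<Rightarrow> 'm list set \<Rightarrow> bool" where
  "sim_sets L M S S' \<longleftrightarrow> (\<exists>ss ss'. set ss = S \<and> set ss' = S' \<and> length ss = length ss' \<and>
     sim L M (concat ss) (concat ss'))"

definition sim_fin ::
    "('f, 'r) language \<Rightarrow> ('f, 'r, 'm) struct \<Rightarrow> 'm list set \<Rightarrow> 'm list set \<Rightarrow> bool" where
  "sim_fin L M S S' \<longleftrightarrow>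
     (\<forall>S0\<subseteq>S. finite S0 \<longrightarrow> (\<exists>S0'\<subseteq>S'. sim_sets L M S0 S0')) \<and>
     (\<forall>S0'\<subseteq>S'. finite S0' \<longrightarrow> (\<exists>S0\<subseteq>S. sim_sets L M S0' S0))"


section \<open>Generalized indiscernibles and the modeling property\<close>

text \<open>A tuple of length \<open>V\<close> is a function restricted to \<open>V\<close>; \<open>cat a \<eta>\<close> is the concatenation of the
  tuples \<open>a (\<eta>\<^sub>0), a (\<eta>\<^sub>1), \<dots>\<close>, with index set \<open>{..<length \<eta>} \<times> V\<close>.\<close>

definition cat :: "('i \<Rightarrow> 'v \<Rightarrow> 'm) \<Rightarrow> 'i list \<Rightarrow> nat \<times> 'v \<Rightarrow> 'm" where
  "cat a \<eta> = (\<lambda>(j, v). a (\<eta> ! j) v)"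

definition indexed_in :: "('lf, 'lr, 'i) struct \<Rightarrow> ('f, 'r, 'm) struct \<Rightarrow> 'v set
    \<Rightarrow> ('i \<Rightarrow> 'v \<Rightarrow> 'm) \<Rightarrow> bool" where
  "indexed_in I M V a \<longleftrightarrow> (\<forall>\<eta>\<in>carrier I. \<forall>v\<in>V. a \<eta> v \<in> carrier M)"

definition indiscernible :: "('lf, 'lr) language \<Rightarrow> ('lf, 'lr, 'i) struct \<Rightarrow>
    ('f, 'r) language \<Rightarrow> ('f, 'r, 'm) struct \<Rightarrow> 'm set \<Rightarrow> 'v set \<Rightarrow> ('i \<Rightarrow> 'v \<Rightarrow> 'm) \<Rightarrow> bool" where
  "indiscernible Lst I L M A V a \<longleftrightarrow> indexed_in I M V a \<and>
    (\<forall>\<eta>\<in>lists (carrier I). \<forall>\<nu>\<in>lists (carrier I). sim Lst I \<eta> \<nu> \<longrightarrow>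
       tp L M A ({..<length \<eta>} \<times> V) (cat a \<eta>) = tp L M A ({..<length \<nu>} \<times> V) (cat a \<nu>))"

text \<open>A definition cannot quantify over types, so the types in which the languages, monster models,
  index sets of tuples, cardinals etc. of the following definitions live are explicit parameters.
  A theorem with these properties as hypotheses is quantified over the parameters outermost; hence
  it is at least as strong as with the hypotheses required for all types.  No theory occurs in
  \<open>modeling_property\<close> since every structure is a model of its own theory.\<close>

definition modeling_property ::
    "'f itself \<Rightarrow> 'r itself \<Rightarrow> 'm itself \<Rightarrow> 'v itself \<Rightarrow> 'k itself \<Rightarrow>
     ('lf, 'lr) language \<Rightarrow> ('lf, 'lr, 'i) struct \<Rightarrow> bool" where
  "modeling_property tf tr tm tv tk Lst I \<longleftrightarrow>
    (\<forall>(L :: ('f, 'r) language) (M :: ('f, 'r, 'm) struct) (\<kappa> :: 'k rel) A (V :: 'v set) a.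
       is_structure L M \<longrightarrow> sufficiently_saturated \<kappa> I L M \<longrightarrow>
       A \<subseteq> carrier M \<longrightarrow> |A| <o \<kappa> \<longrightarrow> |V| <o \<kappa> \<longrightarrow> indexed_in I M V a \<longrightarrow>
       (\<exists>b. indiscernible Lst I L M A V b \<and>
         (\<forall>\<eta>\<in>lists (carrier I). \<forall>\<theta>\<in>tp L M A ({..<length \<eta>} \<times> V) (cat b \<eta>).
            \<exists>\<nu>\<in>lists (carrier I). sim Lst I \<nu> \<eta> \<and>
              \<theta> \<in> tp L M A ({..<length \<nu>} \<times> V) (cat a \<nu>))))"


section \<open>Conditions on index structures\<close>

definition weakly_monochromatic ::
    "nat \<Rightarrow> ('lf, 'lr) language \<Rightarrow> ('lf, 'lr, 'i) struct \<Rightarrow> bool" where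
  "weakly_monochromatic k Lst I \<longleftrightarrow>
     finite (tuples k (carrier I) //
       {(\<eta>, \<nu>). \<eta> \<in> tuples k (carrier I) \<and> \<nu> \<in> tuples k (carrier I) \<and>
          (\<exists>h. isomorphism Lst (generated Lst I \<eta>) (generated Lst I \<nu>) h)})"

text \<open>The ages of \<open>I\<close> and \<open>J\<close> are compared on the type \<open>'i + 'j\<close>, where both have a copy of each
  of their members.\<close>

definition mono_extendable ::
    "'c itself \<Rightarrow> 'j itself \<Rightarrow> nat \<Rightarrow> ('lf, 'lr) language \<Rightarrow> ('lf, 'lr, 'i) struct \<Rightarrow>
     'i list set \<Rightarrow> bool" where
  "mono_extendable tc tj k Lst I S \<longleftrightarrow>
    (\<forall>\<mu> :: 'c rel. Card_order \<mu> \<longrightarrow>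
      (\<exists>J :: ('lf, 'lr, 'j) struct. is_structure Lst J \<and>
        (age Lst J :: ('lf, 'lr, 'i + 'j) struct set) = age Lst I \<and>
        (\<forall>c. c \<in> tuples k (carrier J) \<rightarrow> Field \<mu> \<longrightarrow>
          (\<exists>f. embedding Lst I J f \<and>
            (\<forall>\<eta>\<in>S. \<forall>\<nu>\<in>S. isomorphic_over Lst I \<eta> \<nu> \<longrightarrow> c (map f \<eta>) = c (map f \<nu>))))))"

definition cofinal_in ::
    "nat \<Rightarrow> ('lf, 'lr) language \<Rightarrow> ('lf, 'lr, 'i) struct \<Rightarrow> 'i list set \<Rightarrow> bool" where
  "cofinal_in k Lst I X \<longleftrightarrow>
    (\<forall>Z\<subseteq>carrier I. finite Z \<longrightarrow> (\<exists>f zs. embedding Lst I I f \<and> set zs = Z \<and>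
       f ` carrier I \<inter> Z = {} \<and>
       (\<forall>\<eta>\<in>lists (f ` carrier I). \<forall>\<nu>\<in>lists (f ` carrier I).
          sim Lst I \<eta> \<nu> \<longrightarrow> sim Lst I (\<eta> @ zs) (\<nu> @ zs)) \<and>
       sim_fin Lst I (tuples k (f ` carrier I) \<inter> X) X))"

text \<open>The quintuple \<open>(Lst, I, k, X, Ys)\<close> satisfies the \<open>n\<close>-variable theorem.\<close>

definition n_variable ::
    "'f itself \<Rightarrow> 'r itself \<Rightarrow> 'm itself \<Rightarrow> 'v itself \<Rightarrow> 'k itself \<Rightarrow> 'c itself \<Rightarrow> 'j itself \<Rightarrow>
     ('lf, 'lr) language \<Rightarrow> ('lf, 'lr, 'i) struct \<Rightarrow> nat \<Rightarrow> 'i list set \<Rightarrow> 'i list set set \<Rightarrow> bool"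
  where
  "n_variable tf tr tm tv tk tc tj Lst I k X Ys \<longleftrightarrow>
     is_structure Lst I \<and> X \<subseteq> tuples k (carrier I) \<and> finite Ys \<and> (\<forall>Y\<in>Ys. Y \<subseteq> tuples k (carrier I)) \<and>
     modeling_property tf tr tm tv tk Lst I \<and>
     weakly_monochromatic k Lst I \<and>
     cofinal_in k Lst I X \<and>
     (let XX = {\<eta> \<in> tuples k (carrier I). \<exists>\<nu>\<in>X. isomorphic_over Lst I \<eta> \<nu>} in
        mono_extendable tc tj k Lst I XX \<and> (\<forall>Y\<in>Ys. Y \<subseteq> XX)) \<and>
     (\<forall>Y\<in>Ys. infinite Y \<or> card Y > 1) \<and>
     (\<exists>W X' Y'. W \<subseteq> tuples k (carrier I) \<and> W = X' \<union> Y' \<and> X' \<inter> Y' = {} \<and>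
        sim_fin Lst I X' X \<and> (\<exists>Y\<in>Ys. sim_fin Lst I Y' Y) \<and>
        (\<forall>\<nu>\<in>Y'. sim_fin Lst I ({\<nu>} \<union> X') X))"


section \<open>The class of theories defined by a quintuple\<close>

text \<open>In \<open>\<phi>(x, y\<^sub>0, \<dots>, y\<^sub>k\<^sub>-\<^sub>1)\<close> with \<open>|x| = n\<close> and \<open>|y\<^sub>i| = l\<close>, the variables of the tuple \<open>x\<close> come first,
  followed by those of \<open>y\<^sub>0\<close>, of \<open>y\<^sub>1\<close>, etc.  \<open>params l a \<eta>\<close> is the value for \<open>(y\<^sub>0, \<dots>, y\<^sub>k\<^sub>-\<^sub>1)\<close>.\<close>

definition params :: "nat \<Rightarrow> ('i \<Rightarrow> nat \<Rightarrow> 'm) \<Rightarrow> 'i list \<Rightarrow> 'm list" where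
  "params l a \<eta> = concat (map (\<lambda>i. map (a i) [0..<l]) \<eta>)"

definition realizes :: "('f, 'r, 'm) struct \<Rightarrow> ('f, 'r) fm \<Rightarrow> nat \<Rightarrow> ('i \<Rightarrow> nat \<Rightarrow> 'm) \<Rightarrow> 'i list set \<Rightarrow>
    'm list \<Rightarrow> bool" where
  "realizes M \<phi> l a S b \<longleftrightarrow> (\<forall>\<eta>\<in>S. holds M \<phi> (b @ params l a \<eta>))"

text \<open>Consistency with the elementary diagram of \<open>M\<close>, that is, finite satisfiability in \<open>M\<close>.\<close>

definition consistent :: "('f, 'r, 'm) struct \<Rightarrow> ('f, 'r) fm \<Rightarrow> nat \<Rightarrow> nat \<Rightarrow> ('i \<Rightarrow> nat \<Rightarrow> 'm) \<Rightarrow>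
    'i list set \<Rightarrow> bool" where
  "consistent M \<phi> n l a S \<longleftrightarrow>
     (\<forall>S0\<subseteq>S. finite S0 \<longrightarrow> (\<exists>b\<in>tuples n (carrier M). realizes M \<phi> l a S0 b))"

definition witnesses :: "('lf, 'lr) language \<Rightarrow> ('lf, 'lr, 'i) struct \<Rightarrow> nat \<Rightarrow> 'i list set \<Rightarrow>
    'i list set set \<Rightarrow> ('f, 'r) language \<Rightarrow> ('f, 'r, 'm) struct \<Rightarrow> ('f, 'r) fm \<Rightarrow> nat \<Rightarrow> nat \<Rightarrow>
    ('i \<Rightarrow> nat \<Rightarrow> 'm) \<Rightarrow> bool" where
  "witnesses Lst I k X Ys L M \<phi> n l a \<longleftrightarrow>
     0 < n \<and> \<phi> \<in> formulas L (n + k * l) \<and>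
     indiscernible Lst I L M {} {..<l} a \<and>
     consistent M \<phi> n l a X \<and> (\<forall>Y\<in>Ys. \<not> consistent M \<phi> n l a Y)"

text \<open>\<open>tn\<close> is the type of the elements of the models considered; as a hypothesis of a theorem,
  \<open>T \<notin> D_class TYPE('n) \<dots>\<close> for a type variable \<open>'n\<close> means that a witness exists over some type.\<close>

definition D_class :: "'n itself \<Rightarrow> ('lf, 'lr) language \<Rightarrow> ('lf, 'lr, 'i) struct \<Rightarrow> nat \<Rightarrow>
    'i list set \<Rightarrow> 'i list set set \<Rightarrow> ('f, 'r) language \<Rightarrow> ('f, 'r) fm set set" where
  "D_class tn Lst I k X Ys L = {T. complete_theory L T \<and>
     \<not> (\<exists>(N :: ('f, 'r, 'n) struct) \<phi> n l a. is_structure L N \<and> models N T \<and>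
          witnesses Lst I k X Ys L N \<phi> n l a)}"

end

(* The class of witnesses is closed under lowering the number n of object variables as long as some
   realization b of phi over X has an algebraic coordinate.  If b_i is algebraic over the indexed
   elements and the remaining coordinates b', conjoin the algebraic formula with finitely many instances
   of phi over X so that the set of solutions Psi(-, b') is as small as possible; then each solution
   satisfies all instances of phi over X.  Hence b' satisfies
     (exists c. Psi(c, x')) and (forall c. Psi(c, x') --> phi(c, x', y))
   over X, while over Y a realization of this formula yields one of phi.  Its finitely many parameters
   are absorbed into the indiscernible by cofinality.  The descent cannot reach n = 0: a formula in the
   parameters alone that holds over X holds, by the amalgamation condition (vii), over some Y. *)

theory Submission
  imports Defs
begin

section \<open>Relabelling variables\<close>

text \<open>A realization over Y of the new formula yields one of \<open>\<phi>\<close> because Psi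
  carries fixed parameters and none of the variables y: a c found for one instance satisfies Psi in
  every instance, and the universal part then gives phi(c, x', y) for all of them with this single
  c. The obstacle is that these parameters come from the indiscernible itself. Once they are
  appended to every tuple, equal quantifier-free types of indices need no longer give equal types,
  since the position relative to the indices of the parameters counts too. Cofinality, with Z the
  set of these indices, gives an embedding f of I into I such that types inside f(I) do not see Z;
  re-indexing along f restores indiscernibility, and the similarity of f(I)^k \<inter> X to X keeps
  consistency over X. The tuples grow in each descent; there is a place for the parameters because k
  > 0, which |Y| > 1 forces. A failure of T to be in D may be witnessed in any model of T, so the
  witness has to be moved into M: completeness makes the models elementarily equivalent, and
  saturation of M realizes the type of the whole indexed family.\<close>

lemma eval_tm_cong:
  "(\<And>i. i \<in> fv_tm t \<Longrightarrow> e i = e' i) \<Longrightarrow> eval_tm M e t = eval_tm M e' t"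
proof (induction t)
  case (App f ts)
  then have "map (eval_tm M e) ts = map (eval_tm M e') ts" by auto
  then show ?case by (metis eval_tm.simps(2))
qed simp

lemma sat_cong:
  "(\<And>i. i \<in> fv \<phi> \<Longrightarrow> e i = e' i) \<Longrightarrow> sat M e \<phi> = sat M e' \<phi>"
proof (induction \<phi> arbitrary: e e')
  case (Equal s t)
  then show ?case using eval_tm_cong[of s e e' M] eval_tm_cong[of t e e' M] by simp
next
  case (Atom r ts)
  then have "map (eval_tm M e) ts = map (eval_tm M e') ts" by (auto intro!: eval_tm_cong)
  then show ?case by (metis sat.simps(3))
next
  case (Neg \<phi>)
  then show ?case by (metis fv.simps(4) sat.simps(4))
next
  case (Conj \<phi> \<psi>)
  then show ?case by (metis UnCI fv.simps(5) sat.simps(5))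
next
  case (Exists j \<phi>)
  have "sat M (e(j := a)) \<phi> = sat M (e'(j := a)) \<phi>" for a
    using Exists.prems by (intro Exists.IH) auto
  then show ?case by simp
qed simp

lemma finite_fv_tm: "finite (fv_tm t)"
  by (induction t) auto

lemma finite_fv: "finite (fv \<phi>)"
  by (induction \<phi>) (auto simp: finite_fv_tm)

fun ren_tm :: "(nat \<Rightarrow> nat) \<Rightarrow> 'f tm \<Rightarrow> 'f tm" where
  "ren_tm g (Var i) = Var (g i)"
| "ren_tm g (App f ts) = App f (map (ren_tm g) ts)"

text \<open>The bound variable is replaced by one outside the image of the free variables, so
  \<open>g\<close> may be any function, even one that identifies variables, and nothing is
  captured.\<close>

fun ren :: "(nat \<Rightarrow> nat) \<Rightarrow> ('f, 'r) fm \<Rightarrow> ('f, 'r) fm" where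
  "ren g Falsum = Falsum"
| "ren g (Equal s t) = Equal (ren_tm g s) (ren_tm g t)"
| "ren g (Atom r ts) = Atom r (map (ren_tm g) ts)"
| "ren g (Neg \<phi>) = Neg (ren g \<phi>)"
| "ren g (Conj \<phi> \<psi>) = Conj (ren g \<phi>) (ren g \<psi>)"
| "ren g (Exists i \<phi>) = (let j = (LEAST j. j \<notin> g ` fv \<phi>) in Exists j (ren (g(i := j)) \<phi>))"

lemma eval_ren_tm: "eval_tm M e (ren_tm g t) = eval_tm M (\<lambda>i. e (g i)) t"
proof (induction t)
  case (App f ts)
  then have "map (eval_tm M e \<circ> ren_tm g) ts = map (eval_tm M (\<lambda>i. e (g i))) ts" by auto
  then show ?case by (metis eval_tm.simps(2) map_map ren_tm.simps(2))
qed simp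

lemma Least_not_in_finite: "finite (A :: nat set) \<Longrightarrow> (LEAST j. j \<notin> A) \<notin> A"
  by (metis LeastI ex_new_if_finite infinite_UNIV_nat)

lemma sat_ren: "sat M e (ren g \<phi>) = sat M (\<lambda>i. e (g i)) \<phi>"
proof (induction \<phi> arbitrary: e g)
  case (Atom r ts)
  have "map (eval_tm M e \<circ> ren_tm g) ts = map (eval_tm M (\<lambda>i. e (g i))) ts"
    by (auto simp: eval_ren_tm)
  then show ?case by (metis map_map ren.simps(3) sat.simps(3))
next
  case (Exists i \<phi>)
  define j where "j = (LEAST j. j \<notin> g ` fv \<phi>)"
  have j: "j \<notin> g ` fv \<phi>"
    unfolding j_def by (intro Least_not_in_finite finite_imageI finite_fv)
  have "sat M (e(j := a)) (ren (g(i := j)) \<phi>) = sat M ((\<lambda>i. e (g i))(i := a)) \<phi>" for a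
    unfolding Exists.IH using j by (intro sat_cong) auto
  then show ?case by (simp add: Let_def j_def[symmetric])
qed (auto simp: eval_ren_tm)

lemma fv_ren_tm: "fv_tm (ren_tm g t) = g ` fv_tm t"
  by (induction t) auto

lemma fv_ren: "fv (ren g \<phi>) \<subseteq> g ` fv \<phi>"
proof (induction \<phi> arbitrary: g)
  case (Exists i \<phi>)
  define j where "j = (LEAST j. j \<notin> g ` fv \<phi>)"
  have "fv (ren (g(i := j)) \<phi>) - {j} \<subseteq> g ` (fv \<phi> - {i})"
    using Exists.IH[of "g(i := j)"] by fastforce
  then show ?case by (simp add: Let_def j_def[symmetric])
next
  case (Conj \<phi> \<psi>)
  then show ?case by (simp add: image_Un) blast
qed (auto simp: fv_ren_tm)

lemma wf_ren_tm: "wf_tm L (ren_tm g t) = wf_tm L t"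
  by (induction t) auto

lemma wf_ren: "wf_fm L (ren g \<phi>) = wf_fm L \<phi>"
  by (induction \<phi> arbitrary: g) (auto simp: wf_ren_tm Let_def)

text \<open>Substitutions are given by names instead of index arithmetic: \<open>zs\<close> names
  the variables of the old formula, \<open>xs\<close> those of the new one, and a function on names
  supplies the values for both. A name may occur repeatedly in either list; in \<open>zs\<close>
  this identifies variables.\<close>

definition relabel :: "'w list \<Rightarrow> 'w list \<Rightarrow> ('f, 'r) fm \<Rightarrow> ('f, 'r) fm" where
  "relabel xs zs = ren (\<lambda>i. SOME j. j < length xs \<and> xs ! j = zs ! i)"

lemma relabel_index:
  assumes "set zs \<subseteq> set xs" "i < length zs"
  shows "(SOME j. j < length xs \<and> xs ! j = zs ! i) < length xs"
    and "xs ! (SOME j. j < length xs \<and> xs ! j = zs ! i) = zs ! i"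
proof -
  have "\<exists>j. j < length xs \<and> xs ! j = zs ! i"
    using assms by (metis in_mono in_set_conv_nth nth_mem)
  from someI_ex[OF this] show "(SOME j. j < length xs \<and> xs ! j = zs ! i) < length xs"
    and "xs ! (SOME j. j < length xs \<and> xs ! j = zs ! i) = zs ! i" by auto
qed

lemma holds_relabel:
  assumes "\<phi> \<in> formulas L (length zs)" "set zs \<subseteq> set xs"
  shows "holds M (relabel xs zs \<phi>) (map g xs) \<longleftrightarrow> holds M \<phi> (map g zs)"
  unfolding holds_def relabel_def sat_ren using assms relabel_index[OF assms(2)]
  by (intro sat_cong) (force simp: formulas_def)

lemma relabel_formulas:
  assumes "\<phi> \<in> formulas L (length zs)" "set zs \<subseteq> set xs" "m = length xs"
  shows "relabel xs zs \<phi> \<in> formulas L m"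
  using assms relabel_index[OF assms(2)]
  fv_ren[of "\<lambda>i. SOME j. j < length xs \<and> xs ! j = zs ! i" \<phi>]
  by (force simp: formulas_def relabel_def wf_ren)

section \<open>Quantifier blocks, finite conjunctions and joint solvability of finitely many
  instances\<close>

lemma Exists_formulas: "\<phi> \<in> formulas L (Suc m) \<Longrightarrow> Exists m \<phi> \<in> formulas L m"
  by (force simp: formulas_def less_Suc_eq)

lemma holds_Exists:
  assumes "\<phi> \<in> formulas L (Suc m)" "length xs = m"
  shows "holds M (Exists m \<phi>) xs \<longleftrightarrow> (\<exists>c\<in>carrier M. holds M \<phi> (xs @ [c]))"
proof -
  have "sat M (((!) xs)(m := c)) \<phi> = sat M ((!) (xs @ [c])) \<phi>" for c
    using assms by (intro sat_cong) (auto simp: formulas_def nth_append less_Suc_eq)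
  then show ?thesis by (simp add: holds_def)
qed

primrec exs :: "nat \<Rightarrow> nat \<Rightarrow> ('f, 'r) fm \<Rightarrow> ('f, 'r) fm" where
  "exs m 0 \<phi> = \<phi>"
| "exs m (Suc n) \<phi> = Exists m (exs (Suc m) n \<phi>)"

lemma exs_formulas: "\<phi> \<in> formulas L (m + n) \<Longrightarrow> exs m n \<phi> \<in> formulas L m"
  by (induction n arbitrary: m) (auto intro: Exists_formulas)

lemma tuples_0 [simp]: "tuples 0 A = {[]}"
  by (auto simp: tuples_def)

lemma tuples_Suc: "tuples (Suc n) A = (\<Union>x\<in>A. (#) x ` tuples n A)"
  by (auto simp: tuples_def length_Suc_conv intro!: bexI)

lemma holds_exs:
  assumes "\<phi> \<in> formulas L (m + n)" "length xs = m"
  shows "holds M (exs m n \<phi>) xs \<longleftrightarrow> (\<exists>b\<in>tuples n (carrier M). holds M \<phi> (xs @ b))"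
  using assms
proof (induction n arbitrary: m xs)
  case (Suc n)
  have "holds M (exs m (Suc n) \<phi>) xs \<longleftrightarrow> (\<exists>c\<in>carrier M. holds M (exs (Suc m) n \<phi>) (xs @ [c]))"
    using Suc.prems by (simp add: holds_Exists[OF exs_formulas])
  also have "\<dots> \<longleftrightarrow> (\<exists>c\<in>carrier M. \<exists>b\<in>tuples n (carrier M). holds M \<phi> ((xs @ [c]) @ b))"
    using Suc.prems by (subst Suc.IH) auto
  also have "\<dots> \<longleftrightarrow> (\<exists>b\<in>tuples (Suc n) (carrier M). holds M \<phi> (xs @ b))"
    by (force simp: tuples_Suc)
  finally show ?case .
qed simp

primrec conjs :: "('f, 'r) fm list \<Rightarrow> ('f, 'r) fm" where
  "conjs [] = Neg Falsum"
| "conjs (\<phi> # \<phi>s) = Conj \<phi> (conjs \<phi>s)"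

lemma conjs_formulas: "set \<phi>s \<subseteq> formulas L m \<Longrightarrow> conjs \<phi>s \<in> formulas L m"
  by (induction \<phi>s) (auto simp: formulas_def)

lemma holds_conjs: "holds M (conjs \<phi>s) xs \<longleftrightarrow> (\<forall>\<phi>\<in>set \<phi>s. holds M \<phi> xs)"
  by (induction \<phi>s) (auto simp: holds_def)

lemma holds_Conj [simp]: "holds M (Conj \<phi> \<psi>) xs \<longleftrightarrow> holds M \<phi> xs \<and> holds M \<psi> xs"
  and holds_Neg [simp]: "holds M (Neg \<phi>) xs \<longleftrightarrow> \<not> holds M \<phi> xs"
  by (auto simp: holds_def)

lemma Conj_formulas: "\<phi> \<in> formulas L m \<Longrightarrow> \<psi> \<in> formulas L m \<Longrightarrow> Conj \<phi> \<psi> \<in> formulas L m"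
  and Neg_formulas: "\<phi> \<in> formulas L m \<Longrightarrow> Neg \<phi> \<in> formulas L m"
  by (auto simp: formulas_def)

definition cell_labels :: "nat \<Rightarrow> nat \<Rightarrow> (nat \<times> nat + nat) list" where
  "cell_labels m i = map (\<lambda>j. Inl (i, j)) [0..<m]"

text \<open>The formula \<exists>x. \<And>i<r. phi(x, y^i) in r blocks y^i of m variables each. The
  name \<open>Inl (i, j)\<close> is entry j of block i, and \<open>Inr\<close> marks the object
  variables, which \<open>\<phi>\<close> has in front but \<open>exs\<close> needs at the end.
  Solvability of finitely many instances thus becomes part of the type of the concatenated
  blocks.\<close>

definition joint :: "nat \<Rightarrow> nat \<Rightarrow> nat \<Rightarrow> ('f, 'r) fm \<Rightarrow> ('f, 'r) fm" where
  "joint n m r \<phi> = exs (r * m) n (conjs (map (\<lambda>i.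
     relabel (concat (map (cell_labels m) [0..<r]) @ map Inr [0..<n])
       (map Inr [0..<n] @ cell_labels m i) \<phi>) [0..<r]))"

lemma joint:
  assumes \<phi>: "\<phi> \<in> formulas L (n + m)"
  shows joint_formulas: "joint n m r \<phi> \<in> formulas L (r * m)"
    and holds_joint: "length yss = r \<Longrightarrow> (\<And>ys. ys \<in> set yss \<Longrightarrow> length ys = m) \<Longrightarrow>
      holds M (joint n m r \<phi>) (concat yss) \<longleftrightarrow>
      (\<exists>b\<in>tuples n (carrier M). \<forall>ys\<in>set yss. holds M \<phi> (b @ ys))"
proof -
  define xs where "xs = concat (map (cell_labels m) [0..<r]) @ (map Inr [0..<n] :: (nat \<times> nat + nat) list)"
  define zs where "zs i = map Inr [0..<n] @ cell_labels m i" for i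
  have len_xs: "length xs = r * m + n"
    by (simp add: xs_def cell_labels_def length_concat comp_def sum_list_triv)
  have len_zs: "length (zs i) = n + m" for i by (simp add: zs_def cell_labels_def)
  have sub: "set (zs i) \<subseteq> set xs" if "i < r" for i
    using that by (auto simp: xs_def zs_def cell_labels_def)
  let ?c = "conjs (map (\<lambda>i. relabel xs (zs i) \<phi>) [0..<r])"
  have c: "?c \<in> formulas L (r * m + n)"
    using \<phi> sub by (force intro!: conjs_formulas relabel_formulas simp: len_xs len_zs)
  have joint: "joint n m r \<phi> = exs (r * m) n ?c"
    by (simp add: joint_def xs_def zs_def)
  show "joint n m r \<phi> \<in> formulas L (r * m)"
    unfolding joint by (rule exs_formulas[OF c])
  assume yss: "length yss = r" "\<And>ys. ys \<in> set yss \<Longrightarrow> length ys = m"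
  have len: "length (concat yss) = r * m"
    using yss by (simp add: length_concat map_idI[of yss] cong: map_cong)
      (metis (no_types, lifting) map_eq_conv sum_list_triv of_nat_id)
  have "holds M ?c (concat yss @ b) \<longleftrightarrow> (\<forall>ys\<in>set yss. holds M \<phi> (b @ ys))"
    if b: "b \<in> tuples n (carrier M)" for b
  proof -
    define g where "g = case_sum (\<lambda>(i, j). yss ! i ! j) ((!) b)"
    have b': "map g (map Inr [0..<n]) = b"
      using b by (intro nth_equalityI) (auto simp: g_def tuples_def)
    have cell: "map g (cell_labels m i) = yss ! i" if "i < r" for i
      using that yss by (intro nth_equalityI) (auto simp: g_def cell_labels_def)
    have "map (map g \<circ> cell_labels m) [0..<r] = yss"
      using yss cell by (intro nth_equalityI) auto
    then have "map g xs = concat yss @ b"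
      using b' by (simp add: xs_def map_concat)
    moreover have "map g (zs i) = b @ yss ! i" if "i < r" for i
      using b' cell[OF that] by (simp add: zs_def)
    ultimately have "holds M (relabel xs (zs i) \<phi>) (concat yss @ b) \<longleftrightarrow> holds M \<phi> (b @ yss ! i)"
      if "i < r" for i
      using holds_relabel[of \<phi> L "zs i" xs M g] \<phi> sub[OF that] that by (simp add: len_zs)
    then show ?thesis using yss(1) by (auto simp: holds_conjs all_set_conv_all_nth)
  qed
  then show "holds M (joint n m r \<phi>) (concat yss) \<longleftrightarrow>
      (\<exists>b\<in>tuples n (carrier M). \<forall>ys\<in>set yss. holds M \<phi> (b @ ys))"
    unfolding joint holds_exs[OF c len] by blast
qed

text \<open>Equality of types over the empty set, stated across two structures so that it also
  serves for transfer between models; on empty lists it is elementary equivalence.\<close>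

definition same_type :: "('f, 'r) language \<Rightarrow> ('f, 'r, 'm) struct \<Rightarrow> ('f, 'r, 'n) struct \<Rightarrow>
    'm list \<Rightarrow> 'n list \<Rightarrow> bool" where
  "same_type L M N xs ys \<longleftrightarrow> length xs = length ys \<and>
     (\<forall>\<psi>\<in>formulas L (length xs). holds M \<psi> xs \<longleftrightarrow> holds N \<psi> ys)"

lemma same_type_joint:
  assumes "\<phi> \<in> formulas L (n + m)" "same_type L M N (concat yss) (concat zss)"
    "length yss = length zss"
    "\<And>ys. ys \<in> set yss \<Longrightarrow> length ys = m" "\<And>zs. zs \<in> set zss \<Longrightarrow> length zs = m"
  shows "(\<exists>b\<in>tuples n (carrier M). \<forall>ys\<in>set yss. holds M \<phi> (b @ ys)) \<longleftrightarrow>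
    (\<exists>b\<in>tuples n (carrier N). \<forall>zs\<in>set zss. holds N \<phi> (b @ zs))"
proof -
  have "length (concat yss) = length yss * m"
    using assms(4) by (induction yss) auto
  then show ?thesis
    using assms(2) joint_formulas[OF assms(1), of "length yss"]
      holds_joint[OF assms(1) refl assms(4), of yss M]
      holds_joint[OF assms(1) refl assms(5), of zss N]
    by (simp add: same_type_def assms(3))
qed

section \<open>Downward Loewenheim-Skolem\<close>

text \<open>A Skolem function for formulas \<open>Exists i \<psi>\<close>. The default
  \<open>d\<close> makes it total, so that every formula can count as a code of an element.\<close>

definition hull_witness :: "('f, 'r, 'm) struct \<Rightarrow> 'm \<Rightarrow> ('f, 'r) fm \<Rightarrow> 'm list \<Rightarrow> 'm" where
  "hull_witness M d \<phi> xs = (case \<phi> of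
     Exists i \<psi> \<Rightarrow> (let P = (\<lambda>c. c \<in> carrier M \<and> sat M ((\<lambda>j. if j < length xs then xs ! j else d)(i := c)) \<psi>)
       in if \<exists>c. P c then SOME c. P c else d)
   | _ \<Rightarrow> d)"

text \<open>A formula \<open>Conj \<phi> (Conj \<psi>\<^sub>1 (\<dots> (Conj \<psi>\<^sub>n Falsum)))\<close> serves as a code for the Skolem term with function
  symbol \<open>\<phi>\<close> and arguments \<open>\<psi>\<^sub>1, \<dots>, \<psi>\<^sub>n\<close>.\<close>

fun skolem :: "('f, 'r, 'm) struct \<Rightarrow> 'm \<Rightarrow> ('f, 'r) fm \<Rightarrow> 'm"
  and skolems :: "('f, 'r, 'm) struct \<Rightarrow> 'm \<Rightarrow> ('f, 'r) fm \<Rightarrow> 'm list" where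
  "skolem M d (Conj \<phi> \<psi>) = hull_witness M d \<phi> (skolems M d \<psi>)"
| "skolem M d _ = d"
| "skolems M d (Conj \<phi> \<psi>) = skolem M d \<phi> # skolems M d \<psi>"
| "skolems M d _ = []"

lemma skolems_surj: "xs \<in> lists (range (skolem M d)) \<Longrightarrow> \<exists>\<psi>. skolems M d \<psi> = xs"
proof (induction xs)
  case Nil
  then show ?case by (metis skolems.simps(2))
next
  case (Cons x xs)
  then obtain \<phi> \<psi> where "x = skolem M d \<phi>" "skolems M d \<psi> = xs" by auto
  then show ?case by (metis skolems.simps(1))
qed

lemma skolem_in_carrier: "d \<in> carrier M \<Longrightarrow> skolem M d \<phi> \<in> carrier M"
proof (cases \<phi>)
  assume d: "d \<in> carrier M"
  have *: "hull_witness M d \<chi> xs \<in> carrier M" for \<chi> xs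
  proof (cases \<chi>)
    case (Exists i \<psi>)
    show ?thesis
      using d someI_ex[of "\<lambda>c. c \<in> carrier M \<and> sat M ((\<lambda>j. if j < length xs then xs ! j else d)(i := c)) \<psi>"]
      by (auto simp: hull_witness_def Let_def Exists)
  qed (auto simp: hull_witness_def d)
  case (Conj \<phi>1 \<phi>2)
  then show ?thesis using * by simp
qed auto

text \<open>The Tarski-Vaught criterion for the range of \<open>skolem\<close>: only the finitely
  many values of \<open>e\<close> at free variables matter, their list has a code
  \<open>\<psi>\<close>, and \<open>Conj (Exists i \<phi>) \<psi>\<close> is then the code of a
  witness.\<close>

lemma tarski_vaught:
  assumes e: "\<And>j. e j \<in> range (skolem M d)" and c: "c \<in> carrier M" "sat M (e(i := c)) \<phi>"
  shows "\<exists>c\<in>range (skolem M d). sat M (e(i := c)) \<phi>"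
proof -
  obtain m where m: "fv \<phi> \<subseteq> {..<m}"
    using finite_fv[of \<phi>] by (auto simp: finite_nat_set_iff_bounded)
  define xs where "xs = map e [0..<m]"
  obtain \<psi> where \<psi>: "skolems M d \<psi> = xs"
    using skolems_surj[of xs M d] e by (metis (no_types, lifting) in_listsI in_set_conv_nth length_map nth_map xs_def)
  let ?P = "\<lambda>c. c \<in> carrier M \<and> sat M ((\<lambda>j. if j < length xs then xs ! j else d)(i := c)) \<phi>"
  have *: "sat M ((\<lambda>j. if j < length xs then xs ! j else d)(i := c)) \<phi> = sat M (e(i := c)) \<phi>" for c
    using m by (intro sat_cong) (auto simp: xs_def)
  then have P: "?P (SOME c. ?P c)" using c by (intro someI[of ?P c]) auto
  have "skolem M d (Conj (Exists i \<phi>) \<psi>) = (SOME c. ?P c)"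
    using P by (auto simp: \<psi> hull_witness_def Let_def)
  then show ?thesis using P * by (metis rangeI)
qed

text \<open>The range of \<open>skolem\<close> is an elementary substructure of \<open>M\<close>;
  choosing one code for each of its elements moves it to the type of formulas, the only place where
  \<open>entails\<close> looks.\<close>

definition hull :: "('f, 'r, 'm) struct \<Rightarrow> 'm \<Rightarrow> ('f, 'r, ('f, 'r) fm) struct" where
  "hull M d = \<lparr>carrier = inv (skolem M d) ` range (skolem M d),
     fint = (\<lambda>f xs. inv (skolem M d) (fint M f (map (skolem M d) xs))),
     rint = (\<lambda>r xs. rint M r (map (skolem M d) xs))\<rparr>"

text \<open>Closure under function symbols is the Tarski-Vaught criterion for the formula y = f(x_0,
  ..., x_{n-1}), whose only solution is the value of f.\<close>

lemma fint_hull: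
  assumes "is_structure L M" "d \<in> carrier M" "f \<in> funs L" "length xs = farity L f"
    "xs \<in> lists (range (skolem M d))"
  shows "fint M f xs \<in> range (skolem M d)"
proof -
  define e where "e j = (if j < length xs then xs ! j else skolem M d Falsum)" for j
  let ?\<phi> = "Equal (Var (length xs)) (App f (map Var [0..<length xs]))"
  have "xs \<in> lists (carrier M)"
    using assms(5) skolem_in_carrier[OF assms(2)] by (auto simp: lists_eq_set)
  then have c: "fint M f xs \<in> carrier M"
    using assms by (auto simp: is_structure_def)
  have sat: "sat M (e(length xs := c)) ?\<phi> \<longleftrightarrow> c = fint M f xs" for c
  proof -
    have "map (eval_tm M (e(length xs := c))) (map Var [0..<length xs]) = xs"
      by (intro nth_equalityI) (auto simp: e_def)
    then show ?thesis by (simp del: map_map)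
  qed
  have "e j \<in> range (skolem M d)" for j
    using assms(5) rangeI[of "skolem M d" Falsum] by (auto simp: e_def lists_eq_set dest: nth_mem)
  from tarski_vaught[of e M d _ "length xs" ?\<phi>, OF this c] show ?thesis
    unfolding sat by auto
qed

lemma is_structure_hull:
  assumes "is_structure L M" "d \<in> carrier M"
  shows "is_structure L (hull M d)"
  unfolding is_structure_def
proof (intro conjI ballI impI)
  show "carrier (hull M d) \<noteq> {}" by (simp add: hull_def)
  fix f xs assume f: "f \<in> funs L" and xs: "xs \<in> lists (carrier (hull M d))" "length xs = farity L f"
  then have "fint M f (map (skolem M d) xs) \<in> range (skolem M d)"
    by (intro fint_hull[OF assms f]) auto
  then show "fint (hull M d) f xs \<in> carrier (hull M d)" by (simp add: hull_def)
qed

lemma eval_hull: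
  assumes "is_structure L M" "d \<in> carrier M"
  shows "wf_tm L t \<Longrightarrow> (\<And>j. e j \<in> carrier (hull M d)) \<Longrightarrow>
    eval_tm (hull M d) e t \<in> carrier (hull M d) \<and>
    skolem M d (eval_tm (hull M d) e t) = eval_tm M (\<lambda>j. skolem M d (e j)) t"
proof (induction t)
  case (App f ts)
  have ts: "map (skolem M d) (map (eval_tm (hull M d) e) ts) = map (eval_tm M (\<lambda>j. skolem M d (e j))) ts"
    and in_hull: "map (eval_tm (hull M d) e) ts \<in> lists (carrier (hull M d))"
    using App by auto
  have "fint M f (map (skolem M d) (map (eval_tm (hull M d) e) ts)) \<in> range (skolem M d)"
    using App.prems by (intro fint_hull[OF assms]) auto
  then have "skolem M d (fint (hull M d) f (map (eval_tm (hull M d) e) ts)) =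
      fint M f (map (skolem M d) (map (eval_tm (hull M d) e) ts))"
    by (simp add: hull_def f_inv_into_f)
  moreover have "fint (hull M d) f (map (eval_tm (hull M d) e) ts) \<in> carrier (hull M d)"
    using is_structure_hull[OF assms] in_hull App.prems
    by (simp add: is_structure_def del: map_map lists_eq_set in_listsI)
  ultimately show ?case by (simp only: eval_tm.simps ts)
qed simp

lemma skolem_hull_inj: "x \<in> carrier (hull M d) \<Longrightarrow> y \<in> carrier (hull M d) \<Longrightarrow>
    skolem M d x = skolem M d y \<longleftrightarrow> x = y"
  by (auto simp: hull_def f_inv_into_f)

lemma sat_hull:
  assumes "is_structure L M" "d \<in> carrier M"
  shows "wf_fm L \<phi> \<Longrightarrow> (\<And>j. e j \<in> carrier (hull M d)) \<Longrightarrow>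
    sat (hull M d) e \<phi> \<longleftrightarrow> sat M (\<lambda>j. skolem M d (e j)) \<phi>"
proof (induction \<phi> arbitrary: e)
  case (Equal s t)
  then show ?case
    using eval_hull[OF assms, of s e] eval_hull[OF assms, of t e]
    by (metis sat.simps(2) skolem_hull_inj wf_fm.simps(2))
next
  case (Atom r ts)
  have "map (skolem M d) (map (eval_tm (hull M d) e) ts) = map (eval_tm M (\<lambda>j. skolem M d (e j))) ts"
    using Atom eval_hull[OF assms, of _ e] by auto
  then show ?case by (metis (no_types, lifting) hull_def sat.simps(3) struct.select_convs(3))
next
  case (Exists i \<phi>)
  let ?e = "\<lambda>j. skolem M d (e j)"
  have "(\<exists>c\<in>carrier (hull M d). sat (hull M d) (e(i := c)) \<phi>) \<longleftrightarrow>
      (\<exists>c\<in>carrier (hull M d). sat M (\<lambda>j. skolem M d ((e(i := c)) j)) \<phi>)"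
    using Exists by (intro bex_cong refl Exists.IH) auto
  also have "\<dots> \<longleftrightarrow> (\<exists>c\<in>carrier (hull M d). sat M (?e(i := skolem M d c)) \<phi>)"
    by (intro bex_cong refl arg_cong[where f = "\<lambda>e. sat M e \<phi>"]) auto
  also have "\<dots> \<longleftrightarrow> (\<exists>c\<in>range (skolem M d). sat M (?e(i := c)) \<phi>)"
    by (auto simp: hull_def f_inv_into_f)
  also have "\<dots> \<longleftrightarrow> (\<exists>c\<in>carrier M. sat M (?e(i := c)) \<phi>)"
    using tarski_vaught[of ?e M d _ i \<phi>] skolem_in_carrier[OF assms(2)] by blast
  finally show ?case by simp
qed auto

lemma holds_hull:
  assumes "is_structure L M" "d \<in> carrier M" "\<sigma> \<in> formulas L 0"
  shows "holds (hull M d) \<sigma> [] \<longleftrightarrow> holds M \<sigma> []"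
proof -
  \<comment> \<open>The assignment \<open>(!) []\<close> may leave the carrier. A sentence does not
    see the assignment, so a constant one inside the hull replaces it.\<close>
  define c where "c = inv (skolem M d) d"
  have c: "c \<in> carrier (hull M d)"
    unfolding c_def hull_def by (metis image_eqI rangeI skolem.simps(2) struct.select_convs(1))
  have "holds (hull M d) \<sigma> [] \<longleftrightarrow> sat (hull M d) (\<lambda>_. c) \<sigma>"
    unfolding holds_def using assms(3) by (intro sat_cong) (auto simp: formulas_def)
  also have "\<dots> \<longleftrightarrow> sat M (\<lambda>_. skolem M d c) \<sigma>"
    using assms c by (intro sat_hull) (auto simp: formulas_def)
  also have "\<dots> \<longleftrightarrow> holds M \<sigma> []"
    unfolding holds_def using assms(3) by (intro sat_cong) (auto simp: formulas_def)
  finally show ?thesis .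
qed

text \<open>\<open>M\<close> may live on any type, whereas \<open>entails\<close> inspects
  structures on the type of formulas; the hull of \<open>M\<close> is such a structure and agrees
  with \<open>M\<close> on sentences.\<close>

lemma holds_if_entails:
  assumes "T \<subseteq> formulas L 0" "\<sigma> \<in> formulas L 0" "is_structure L M" "models M T" "entails L T \<sigma>"
  shows "holds M \<sigma> []"
proof -
  obtain d where d: "d \<in> carrier M" using assms(3) by (auto simp: is_structure_def)
  have "models (hull M d) T"
    using assms holds_hull[OF assms(3) d] by (auto simp: models_def)
  then show ?thesis
    using assms holds_hull[OF assms(3) d] is_structure_hull[OF assms(3) d] by (auto simp: entails_def)
qed

lemma complete_theory_elementarily_equivalent:
  assumes "complete_theory L T" "is_structure L M" "models M T" "is_structure L N" "models N T"
  shows "same_type L M N [] []"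
proof -
  have "holds M \<sigma> [] \<longleftrightarrow> holds N \<sigma> []" if \<sigma>: "\<sigma> \<in> formulas L 0" for \<sigma>
    using assms \<sigma> Neg_formulas[OF \<sigma>] holds_if_entails[of T L _ M] holds_if_entails[of T L _ N]
    unfolding complete_theory_def by (metis holds_Neg)
  then show ?thesis by (simp add: same_type_def)
qed

section \<open>Realizing types in saturated structures\<close>

text \<open>A common solution of finitely many requirements is expressed by one existential formula
  in the values of \<open>gs\<close>. The name \<open>None\<close> stands for the quantified
  variable, \<open>Some g\<close> for the parameter at \<open>g\<close>.\<close>

lemma same_type_Exists:
  fixes L :: "('a, 'b) language" and u :: "'g \<Rightarrow> 'm" and v :: "'g \<Rightarrow> 'n"
  assumes "same_type L M N (map u gs) (map v gs)"
    "\<And>\<phi> hs. (\<phi>, hs) \<in> set q \<Longrightarrow> set hs \<subseteq> set gs \<and> \<phi> \<in> formulas L (1 + length hs)"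
  shows "(\<exists>c\<in>carrier M. \<forall>(\<phi>, hs)\<in>set q. holds M \<phi> (c # map u hs)) \<longleftrightarrow>
    (\<exists>c\<in>carrier N. \<forall>(\<phi>, hs)\<in>set q. holds N \<phi> (c # map v hs))"
proof -
  define xs where "xs = map Some gs @ [None]"
  define \<chi> where "\<chi> = conjs (map (\<lambda>(\<phi>, hs). relabel xs (None # map Some hs) \<phi>) q)"
  have sub: "set (None # map Some hs) \<subseteq> set xs" if "(\<phi>, hs) \<in> set q" for \<phi> hs
    using assms(2)[OF that] by (auto simp: xs_def)
  have \<chi>: "\<chi> \<in> formulas L (Suc (length gs))"
    unfolding \<chi>_def using assms(2) sub
    by (intro conjs_formulas) (force intro!: relabel_formulas simp: xs_def)
  have xs: "map (case_option c w) xs = map w gs @ [c]" for c and w :: "'g \<Rightarrow> 'x"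
    by (simp add: xs_def)
  have rel: "holds K (relabel xs (None # map Some hs) \<phi>) (map (case_option c w) xs) \<longleftrightarrow>
      holds K \<phi> (c # map w hs)" if "(\<phi>, hs) \<in> set q" for \<phi> hs c w and K :: "('a, 'b, 'x) struct"
    using holds_relabel[OF _ sub[OF that], of \<phi> L K "case_option c w"] assms(2)[OF that]
    by (simp add: comp_def)
  have 1: "holds M \<chi> (map u gs @ [c]) \<longleftrightarrow> (\<forall>(\<phi>, hs)\<in>set q. holds M \<phi> (c # map u hs))" for c
    unfolding \<chi>_def holds_conjs using rel[of _ _ M c u] by (auto simp: xs)
  have 2: "holds N \<chi> (map v gs @ [c]) \<longleftrightarrow> (\<forall>(\<phi>, hs)\<in>set q. holds N \<phi> (c # map v hs))" for c
    unfolding \<chi>_def holds_conjs using rel[of _ _ N c v] by (auto simp: xs)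
  have "holds M (Exists (length gs) \<chi>) (map u gs) \<longleftrightarrow> holds N (Exists (length gs) \<chi>) (map v gs)"
    using assms(1) Exists_formulas[OF \<chi>] by (simp add: same_type_def)
  then show ?thesis
    using holds_Exists[OF \<chi>, of "map u gs" M] holds_Exists[OF \<chi>, of "map v gs" N]
    by (simp add: 1 2)
qed

lemma saturatedD:
  assumes "saturated \<kappa> L M" "A \<subseteq> carrier M" "|A| <o \<kappa>"
    "p \<subseteq> {(\<phi>, ps). ps \<in> lists A \<and> \<phi> \<in> formulas L (1 + length ps)}"
    "\<And>q. q \<subseteq> p \<Longrightarrow> finite q \<Longrightarrow> \<exists>b\<in>carrier M. \<forall>(\<phi>, ps)\<in>q. holds M \<phi> (b # ps)"
  shows "\<exists>b\<in>carrier M. \<forall>(\<phi>, ps)\<in>p. holds M \<phi> (b # ps)"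
  using assms unfolding saturated_def by blast

text \<open>The forth step of a back-and-forth argument: the type of \<open>c\<close> over the
  values of \<open>u\<close>, carried over to the values of \<open>v\<close>, is finitely
  satisfiable in \<open>M\<close>, hence realized by saturation. Since that type contains each
  formula or its negation, one direction of truth gives the equivalence.\<close>

lemma same_type_Cons:
  assumes "saturated \<kappa> L M" "B \<subseteq> carrier M" "|B| <o \<kappa>" "v ` G \<subseteq> B"
    and G: "\<And>gs. gs \<in> lists G \<Longrightarrow> same_type L N M (map u gs) (map v gs)"
    and c: "c \<in> carrier N"
  shows "\<exists>b\<in>carrier M. \<forall>gs\<in>lists G. same_type L N M (c # map u gs) (b # map v gs)"
proof -
  define P where "P = {(\<phi>, gs). gs \<in> lists G \<and> \<phi> \<in> formulas L (1 + length gs) \<and>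
    holds N \<phi> (c # map u gs)}"
  define p where "p = (\<lambda>(\<phi>, gs). (\<phi>, map v gs)) ` P"
  have "p \<subseteq> {(\<phi>, ps). ps \<in> lists B \<and> \<phi> \<in> formulas L (1 + length ps)}"
    using assms(4) by (auto simp: p_def P_def) blast
  moreover have "\<exists>b\<in>carrier M. \<forall>(\<phi>, ps)\<in>q. holds M \<phi> (b # ps)" if q: "q \<subseteq> p" "finite q" for q
  proof -
    obtain Q where Q: "Q \<subseteq> P" "finite Q" "q = (\<lambda>(\<phi>, gs). (\<phi>, map v gs)) ` Q"
      using finite_subset_image[OF q(2) q(1)[unfolded p_def]] by blast
    obtain qs where qs: "set qs = Q" using Q(2) finite_list by blast
    define gs where "gs = concat (map snd qs)"
    have in_P: "(\<phi>, hs) \<in> P" if "(\<phi>, hs) \<in> set qs" for \<phi> hs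
      using that Q(1) qs by auto
    have sub: "set hs \<subseteq> set gs \<and> \<phi> \<in> formulas L (1 + length hs)" if "(\<phi>, hs) \<in> set qs" for \<phi> hs
      using in_P[OF that] that by (force simp: gs_def P_def)
    have "gs \<in> lists G" using in_P by (fastforce simp: gs_def P_def)
    moreover have "\<exists>c\<in>carrier N. \<forall>(\<phi>, hs)\<in>set qs. holds N \<phi> (c # map u hs)"
      using in_P by (intro bexI[OF _ c]) (auto simp: P_def)
    ultimately have "\<exists>b\<in>carrier M. \<forall>(\<phi>, hs)\<in>set qs. holds M \<phi> (b # map v hs)"
      using same_type_Exists[OF G sub] by blast
    then show ?thesis unfolding Q(3) qs[symmetric] by fastforce
  qed
  ultimately obtain b where b: "b \<in> carrier M" "\<forall>(\<phi>, ps)\<in>p. holds M \<phi> (b # ps)"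
    using saturatedD[OF assms(1-3), of p] by blast
  have pos: "holds M \<phi> (b # map v gs)"
    if "gs \<in> lists G" "\<phi> \<in> formulas L (Suc (length gs))" "holds N \<phi> (c # map u gs)" for \<phi> gs
  proof -
    have "(\<phi>, map v gs) \<in> p" using that by (force simp: p_def P_def)
    with b(2) show ?thesis by blast
  qed
  have "same_type L N M (c # map u gs) (b # map v gs)" if "gs \<in> lists G" for gs
    using pos[OF that] pos[OF that Neg_formulas] by (auto simp: same_type_def)
  with b(1) show ?thesis by blast
qed

lemma same_type_map:
  assumes "same_type L M N (map u xs) (map v xs)" "set zs \<subseteq> set xs"
  shows "same_type L M N (map u zs) (map v zs)"
  using assms relabel_formulas[OF _ assms(2) refl] holds_relabel[OF _ assms(2)]
  unfolding same_type_def by (metis length_map)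

text \<open>Zorn's lemma for partial elementary maps from the family \<open>a\<close> into
  \<open>M\<close>, kept as sets of pairs. Types are finitary, so unions of chains are admissible,
  and the forth step extends any map that is not total.\<close>

lemma same_type_realized:
  fixes a :: "'d \<Rightarrow> 'n" and M :: "('f, 'r, 'm) struct"
  assumes sat: "saturated \<kappa> L M" and D: "|D| <o \<kappa>" "a ` D \<subseteq> carrier N"
    and eq: "same_type L N M [] []"
  shows "\<exists>a'. a' ` D \<subseteq> carrier M \<and> (\<forall>ds\<in>lists D. same_type L N M (map a ds) (map a' ds))"
proof -
  define \<G> where "\<G> = {G. G \<subseteq> D \<times> carrier M \<and>
    (\<forall>gs\<in>lists G. same_type L N M (map (a \<circ> fst) gs) (map snd gs))}"
  have "{} \<in> \<G>" using eq by (simp add: \<G>_def)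
  moreover have "\<Union>\<C> \<in> \<G>" if \<C>: "\<C> \<noteq> {}" "subset.chain \<G> \<C>" for \<C>
  proof -
    have "same_type L N M (map (a \<circ> fst) gs) (map snd gs)" if "gs \<in> lists (\<Union>\<C>)" for gs
    proof -
      have "\<exists>G\<in>\<C>. set gs \<subseteq> G"
        using finite_subset_Union_chain[of "set gs" \<C> \<G>] \<C> that by (auto simp: lists_eq_set)
      then show ?thesis using \<C>(2) by (auto simp: \<G>_def subset.chain_def lists_eq_set)
    qed
    then show ?thesis using \<C>(2) by (auto simp: \<G>_def subset.chain_def)
  qed
  ultimately obtain G where G: "G \<in> \<G>" and max: "\<And>H. H \<in> \<G> \<Longrightarrow> G \<subseteq> H \<Longrightarrow> H = G"
    using subset_Zorn_nonempty[of \<G>] by blast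
  have type: "same_type L N M (map (a \<circ> fst) gs) (map snd gs)" if "gs \<in> lists G" for gs
    using G that by (simp add: \<G>_def)
  \<comment> \<open>The formula x = y belongs to the types, so \<open>G\<close> is the graph of a
    function; this bounds its image by |D| and keeps the parameter set below \<kappa>.\<close>
  have inj: "inj_on fst G"
  proof (rule inj_onI)
    fix g h assume gh: "g \<in> G" "h \<in> G" "fst g = fst h"
    have "Equal (Var 0) (Var 1) \<in> formulas L 2" by (simp add: formulas_def)
    then have "snd g = snd h"
      using type[of "[g, h]"] gh by (auto simp: same_type_def holds_def numeral_2_eq_2)
    with gh(3) show "g = h" by (simp add: prod_eq_iff)
  qed
  have small: "|snd ` G| <o \<kappa>"
  proof -
    have "|snd ` G| \<le>o |G|" by (rule card_of_image)
    also have "|G| \<le>o |D|"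
      using G inj by (intro iffD1[OF card_of_ordLeq] exI[of _ fst]) (auto simp: \<G>_def)
    finally show ?thesis using D(1) by (rule ordLeq_ordLess_trans)
  qed
  have total: "fst ` G = D"
  proof (rule ccontr)
    assume "fst ` G \<noteq> D"
    then obtain d where d: "d \<in> D" "d \<notin> fst ` G" using G by (fastforce simp: \<G>_def)
    have "\<exists>b\<in>carrier M. \<forall>gs\<in>lists G.
        same_type L N M (a d # map (a \<circ> fst) gs) (b # map snd gs)"
      using G D(2) d(1) type small by (intro same_type_Cons[OF sat, of "snd ` G"]) (auto simp: \<G>_def)
    then obtain b where b: "b \<in> carrier M"
      "\<And>gs. gs \<in> lists G \<Longrightarrow> same_type L N M (a d # map (a \<circ> fst) gs) (b # map snd gs)" by blast
    have "same_type L N M (map (a \<circ> fst) hs) (map snd hs)" if hs: "hs \<in> lists (insert (d, b) G)" for hs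
    proof -
      \<comment> \<open>The new pair may occur in \<open>hs\<close> anywhere and repeatedly. The
        forth step covers it once in front of a list from \<open>G\<close>; the arrangement of
        \<open>hs\<close> then follows because types determine types of rearranged and repeated
        entries.\<close>
      define gs where "gs = filter (\<lambda>h. h \<in> G) hs"
      have "gs \<in> lists G" by (auto simp: gs_def)
      from b(2)[OF this] have "same_type L N M (map (a \<circ> fst) ((d, b) # gs)) (map snd ((d, b) # gs))"
        by simp
      then show ?thesis by (rule same_type_map) (use hs in \<open>auto simp: gs_def lists_eq_set\<close>)
    qed
    then have "insert (d, b) G \<in> \<G>" using G d(1) b(1) by (auto simp: \<G>_def)
    from max[OF this] show False using d(2) by force
  qed
  define a' where "a' d = snd (inv_into G fst d)" for d
  have a': "(d, a' d) \<in> G" if "d \<in> D" for d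
    using that total by (metis a'_def f_inv_into_f inv_into_into prod.collapse)
  have "same_type L N M (map a ds) (map a' ds)" if "ds \<in> lists D" for ds
  proof -
    have "map (\<lambda>d. (d, a' d)) ds \<in> lists G" using that a' by (auto simp: lists_eq_set)
    from type[OF this] show ?thesis by (simp add: comp_def)
  qed
  moreover have "a' ` D \<subseteq> carrier M" using a' G by (auto simp: \<G>_def)
  ultimately show ?thesis by blast
qed

section \<open>Sets below the saturation cardinal, and saturation for finite tuples\<close>

lemma infinite_Field_if_natLeq_ordLess:
  assumes "Card_order \<kappa>" "natLeq <o \<kappa>"
  shows "infinite (Field \<kappa>)"
proof
  assume "finite (Field \<kappa>)"
  then have "|Field \<kappa>| <o natLeq" using finite_iff_ordLess_natLeq by blast
  then have "\<kappa> <o natLeq"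
    using card_of_Field_ordIso[OF assms(1)] ordIso_symmetric ordIso_ordLess_trans by blast
  then show False using assms(2) ordLess_irreflexive ordLess_transitive by blast
qed

lemma finite_ordLess_if_natLeq_ordLess: "natLeq <o \<kappa> \<Longrightarrow> finite A \<Longrightarrow> |A| <o \<kappa>"
  using finite_iff_ordLess_natLeq ordLess_transitive by blast

lemma card_of_Times_finite_ordLess:
  assumes "Card_order \<kappa>" "natLeq <o \<kappa>" "|A| <o \<kappa>" "finite B"
  shows "|A \<times> B| <o \<kappa>"
  using assms(4)
proof (induction B)
  case empty
  then show ?case using ordLeq_ordLess_trans[OF card_of_empty assms(3)] by simp
next
  case (insert b B)
  have "|(\<lambda>x. (x, b)) ` A| <o \<kappa>" by (rule ordLeq_ordLess_trans[OF card_of_image assms(3)])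
  then have "|(\<lambda>x. (x, b)) ` A \<union> A \<times> B| <o \<kappa>"
    using insert.IH assms(1,2)
    by (intro card_of_Un_ordLess_infinite_Field infinite_Field_if_natLeq_ordLess)
  moreover have "A \<times> insert b B = (\<lambda>x. (x, b)) ` A \<union> A \<times> B" by auto
  ultimately show ?case by simp
qed

lemma tuples_snoc: "xs \<in> tuples n A \<Longrightarrow> x \<in> A \<Longrightarrow> xs @ [x] \<in> tuples (Suc n) A"
  by (auto simp: tuples_def)

lemma tuples_Suc_snocE:
  assumes "ys \<in> tuples (Suc n) A"
  obtains xs x where "ys = xs @ [x]" "xs \<in> tuples n A" "x \<in> A"
  using assms by (cases ys rule: rev_cases) (auto simp: tuples_def)

text \<open>Saturation speaks of single elements, so the coordinates are found one at a time, the
  last one first: it is chosen such that every finite part of the problem remains solvable in the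
  other coordinates, and it then becomes a parameter.\<close>

lemma saturated_tuples:
  fixes M :: "('f, 'r, 'a) struct"
  assumes "saturated \<kappa> L M" "Card_order \<kappa>" "natLeq <o \<kappa>"
  shows "A \<subseteq> carrier M \<Longrightarrow> |A| <o \<kappa> \<Longrightarrow> Q \<subseteq> tuples m A \<Longrightarrow> \<phi> \<in> formulas L (n + m) \<Longrightarrow>
    (\<And>Q0. Q0 \<subseteq> Q \<Longrightarrow> finite Q0 \<Longrightarrow> \<exists>b\<in>tuples n (carrier M). \<forall>ys\<in>Q0. holds M \<phi> (b @ ys)) \<Longrightarrow>
    \<exists>b\<in>tuples n (carrier M). \<forall>ys\<in>Q. holds M \<phi> (b @ ys)"
proof (induction n arbitrary: m A Q)
  case 0
  have "holds M \<phi> ys" if "ys \<in> Q" for ys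
    using "0.prems"(5)[of "{ys}"] that by simp
  then show ?case by simp
next
  case (Suc n)
  define xs where "xs yss = None # map Some (concat yss)" for yss :: "'a list list"
  define zs where "zs yss = concat (map (\<lambda>ys. None # map Some ys) yss)" for yss :: "'a list list"
  \<comment> \<open>\<open>h yss\<close> says of the last coordinate c that the instances in
    \<open>yss\<close> have a common solution ending in c. Each block of \<open>joint\<close> is c
    followed by an element of \<open>yss\<close>; the name \<open>None\<close> merges all these
    copies of c into variable 0.\<close>
  define h where "h yss = (relabel (xs yss) (zs yss) (joint n (Suc m) (length yss) \<phi>), concat yss)"
    for yss
  have \<phi>: "\<phi> \<in> formulas L (n + Suc m)" using Suc.prems(4) by simp
  have len: "length ys = m" if "ys \<in> set yss" "yss \<in> lists Q" for ys yss
    using that Suc.prems(3) by (auto simp: tuples_def)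
  have joint: "joint n (Suc m) (length yss) \<phi> \<in> formulas L (length (zs yss))"
    if "yss \<in> lists Q" for yss
  proof -
    have "length (zs yss) = length yss * Suc m"
      using len[OF _ that] unfolding zs_def by (induction yss) auto
    then show ?thesis using joint_formulas[OF \<phi>] by simp
  qed
  have sub: "set (zs yss) \<subseteq> set (xs yss)" for yss by (auto simp: xs_def zs_def)
  have h: "snd (h yss) \<in> lists A \<and> fst (h yss) \<in> formulas L (1 + length (snd (h yss)))"
    if "yss \<in> lists Q" for yss
  proof
    show "snd (h yss) \<in> lists A"
      using that Suc.prems(3) by (fastforce simp: h_def tuples_def)
    show "fst (h yss) \<in> formulas L (1 + length (snd (h yss)))"
      using relabel_formulas[OF joint[OF that] sub refl] by (simp add: h_def xs_def)
  qed
  have holds_h: "holds M (fst (h yss)) (c # snd (h yss)) \<longleftrightarrow>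
      (\<exists>b\<in>tuples n (carrier M). \<forall>ys\<in>set yss. holds M \<phi> (b @ c # ys))" if yss: "yss \<in> lists Q" for c yss
  proof -
    have "map (case_option c id) (xs yss) = c # concat yss"
      and "map (case_option c id) (zs yss) = concat (map ((#) c) yss)"
      by (simp_all add: xs_def zs_def map_concat comp_def)
    then have "holds M (fst (h yss)) (c # snd (h yss)) \<longleftrightarrow>
        holds M (joint n (Suc m) (length yss) \<phi>) (concat (map ((#) c) yss))"
      using holds_relabel[OF joint[OF yss] sub, of M "case_option c id"] by (simp add: h_def)
    also have "\<dots> \<longleftrightarrow> (\<exists>b\<in>tuples n (carrier M). \<forall>zs\<in>set (map ((#) c) yss). holds M \<phi> (b @ zs))"
      by (rule holds_joint[OF \<phi>]) (auto simp: len[OF _ yss])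
    finally show ?thesis by simp
  qed
  have "\<exists>c\<in>carrier M. \<forall>(\<phi>, ps)\<in>h ` lists Q. holds M \<phi> (c # ps)"
  proof (rule saturatedD[OF assms(1), of A])
    show "A \<subseteq> carrier M" "|A| <o \<kappa>" by fact+
    show "h ` lists Q \<subseteq> {(\<phi>, ps). ps \<in> lists A \<and> \<phi> \<in> formulas L (1 + length ps)}"
    proof (rule image_subsetI)
      show "h yss \<in> {(\<phi>, ps). ps \<in> lists A \<and> \<phi> \<in> formulas L (1 + length ps)}"
        if "yss \<in> lists Q" for yss
        using h[OF that] by (simp add: case_prod_unfold)
    qed
    fix q assume "q \<subseteq> h ` lists Q" "finite q"
    then obtain C where C: "C \<subseteq> lists Q" "finite C" "q = h ` C"
      by (metis finite_subset_image)
    have "(\<Union>yss\<in>C. set yss) \<subseteq> Q" "finite (\<Union>yss\<in>C. set yss)"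
      using C by (auto simp: lists_eq_set)
    \<comment> \<open>One solution for the union of the finite parts serves all of them at once,
      with the same last entry.\<close>
    from Suc.prems(5)[OF this] obtain b where b: "b \<in> tuples (Suc n) (carrier M)"
      "\<And>yss ys. yss \<in> C \<Longrightarrow> ys \<in> set yss \<Longrightarrow> holds M \<phi> (b @ ys)" by blast
    obtain b' c where c: "b = b' @ [c]" "b' \<in> tuples n (carrier M)" "c \<in> carrier M"
      using b(1) by (rule tuples_Suc_snocE)
    have "holds M (fst (h yss)) (c # snd (h yss))" if "yss \<in> C" for yss
      using holds_h[of yss c] that C(1) b(2)[OF that] c by auto
    with c(3) show "\<exists>c\<in>carrier M. \<forall>(\<phi>, ps)\<in>q. holds M \<phi> (c # ps)"
      by (auto simp: C(3) case_prod_unfold)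
  qed
  then obtain c where c: "c \<in> carrier M"
    "\<And>yss. yss \<in> lists Q \<Longrightarrow> \<exists>b\<in>tuples n (carrier M). \<forall>ys\<in>set yss. holds M \<phi> (b @ c # ys)"
    using holds_h by (auto simp: case_prod_unfold)
  have "\<exists>b\<in>tuples n (carrier M). \<forall>ys\<in>(#) c ` Q. holds M \<phi> (b @ ys)"
  proof (rule Suc.IH[OF _ _ _ \<phi>])
    show "insert c A \<subseteq> carrier M" using c(1) Suc.prems(1) by simp
    show "|insert c A| <o \<kappa>"
      using card_of_Un_ordLess_infinite_Field[OF infinite_Field_if_natLeq_ordLess, of \<kappa> "{c}" A]
        finite_ordLess_if_natLeq_ordLess[of \<kappa> "{c}"] assms Suc.prems(2) by simp
    show "(#) c ` Q \<subseteq> tuples (Suc m) (insert c A)"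
      using Suc.prems(3) by (fastforce simp: tuples_def)
    fix Q0 assume "Q0 \<subseteq> (#) c ` Q" "finite Q0"
    then obtain Q1 where "Q1 \<subseteq> Q" "finite Q1" "Q0 = (#) c ` Q1"
      by (metis finite_subset_image)
    moreover obtain yss where "set yss = Q1" using \<open>finite Q1\<close> finite_list by blast
    ultimately show "\<exists>b\<in>tuples n (carrier M). \<forall>ys\<in>Q0. holds M \<phi> (b @ ys)"
      using c(2)[of yss] by auto
  qed
  then obtain b where "b \<in> tuples n (carrier M)" "\<And>ys. ys \<in> Q \<Longrightarrow> holds M \<phi> (b @ c # ys)" by auto
  then show ?case using c(1) by (intro bexI[of _ "b @ [c]"]) (auto intro: tuples_snoc)
qed

section \<open>Eliminating an algebraic coordinate\<close>

lemma length_params [simp]: "length (params l a \<eta>) = length \<eta> * l"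
  by (induction \<eta>) (auto simp: params_def)

lemma set_params: "set (params l a \<eta>) = {a i v | i v. i \<in> set \<eta> \<and> v < l}"
  by (fastforce simp: params_def)

lemma map_params: "map g (params l a \<eta>) = params l (\<lambda>i v. g (a i v)) \<eta>"
  by (simp add: params_def map_concat comp_def)

lemma params_cong:
  "(\<And>i v. i \<in> set \<eta> \<Longrightarrow> v < l \<Longrightarrow> a i v = a' i v) \<Longrightarrow> params l a \<eta> = params l a' \<eta>"
  by (auto simp: params_def intro!: arg_cong[where f = concat])

lemma params_map: "params l a (map f \<eta>) = params l (\<lambda>i. a (f i)) \<eta>"
  by (simp add: params_def comp_def)

lemma params_conv_nth: "params l a \<eta> = params l (\<lambda>j. a (\<eta> ! j)) [0..<length \<eta>]"
  using params_map[of l a "(!) \<eta>" "[0..<length \<eta>]"] by (simp add: map_nth)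

lemma params_concat: "params l a (concat ss) = concat (map (params l a) ss)"
  by (induction ss) (auto simp: params_def)

definition extend_params :: "nat \<Rightarrow> ('i \<Rightarrow> nat \<Rightarrow> 'm) \<Rightarrow> 'm list \<Rightarrow> 'i \<Rightarrow> nat \<Rightarrow> 'm" where
  "extend_params l w ps = (\<lambda>j v. if v < l then w j v else ps ! (v - l))"

section \<open>Algebraic closure, and dimension read off from positions\<close>

lemma in_acl:
  assumes "x \<in> A" "x \<in> carrier M"
  shows "x \<in> acl L M A"
proof -
  have "Equal (Var 0) (Var 1) \<in> formulas L (1 + length [x])" by (simp add: formulas_def)
  moreover have "holds M (Equal (Var 0) (Var 1)) (c # [x]) \<longleftrightarrow> c = x" for c
    by (simp add: holds_def)
  ultimately show ?thesis
    using assms by (auto simp: acl_def intro!: exI[of _ "Equal (Var 0) (Var 1)"] exI[of _ "[x]"])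
qed

lemma acl_mono: "A \<subseteq> B \<Longrightarrow> acl L M A \<subseteq> acl L M B"
  unfolding acl_def by (blast dest: lists_mono[THEN subsetD])

text \<open>The hypothesis is about positions, while dimension is about sets. A repeated entry would
  be algebraic over the remaining positions, so the entries are distinct and \<open>set b\<close> is
  itself an independent set with n elements.\<close>

lemma alg_dim_eq_length:
  assumes b: "b \<in> tuples n (carrier M)"
    and indep: "\<And>i. i < n \<Longrightarrow> b ! i \<notin> acl L M (A \<union> (set (take i b) \<union> set (drop (Suc i) b)))"
  shows "alg_dim L M b A = n"
proof -
  have len: "length b = n" and carrier: "set b \<subseteq> carrier M" using b by (auto simp: tuples_def)
  have "b ! i \<noteq> b ! j" if "i < j" "j < n" for i j
  proof
    assume eq: "b ! i = b ! j"
    have "b ! j \<in> set (drop (Suc i) b)"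
      using that len nth_mem[of "j - Suc i" "drop (Suc i) b"] by simp
    then have "b ! i \<in> acl L M (A \<union> (set (take i b) \<union> set (drop (Suc i) b)))"
      using that len carrier eq by (intro in_acl) auto
    with indep[of i] that show False by simp
  qed
  then have dist: "distinct b" using len by (metis distinct_conv_nth nat_neq_iff)
  have "alg_independent L M A (set b)"
    unfolding alg_independent_def
  proof
    fix x assume "x \<in> set b"
    then obtain i where i: "i < n" "x = b ! i" using len by (metis in_set_conv_nth)
    have "b = take i b @ b ! i # drop (Suc i) b" using i(1) len by (simp add: id_take_nth_drop)
    then have "set b - {x} \<subseteq> set (take i b) \<union> set (drop (Suc i) b)"
      unfolding i(2) by (metis Diff_subset_conv list.simps(15) set_append sup.left_commute
        insert_is_Un subset_refl sup_assoc)
    then show "x \<notin> acl L M (A \<union> (set b - {x}))"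
      using indep[OF i(1)] acl_mono[of "A \<union> (set b - {x})"] i(2) by blast
  qed
  moreover have "card (set b) = n" using dist len by (simp add: distinct_card)
  moreover have "card B \<le> n" if "B \<subseteq> set b" for B
    using card_mono[OF _ that] \<open>card (set b) = n\<close> by simp
  ultimately show ?thesis
    unfolding alg_dim_def by (intro Max_eqI) (auto intro!: image_eqI[of _ _ "set b"])
qed

text \<open>Names of variables for the elimination: \<open>Obj v\<close> is object variable v of
  \<open>\<phi>\<close>, \<open>Arg j v\<close> is entry v of y_j, and \<open>Elem p\<close> is a
  variable reserved for the fixed parameter p.\<close>

datatype 'm label = Obj nat | Arg nat nat | Elem 'm

primrec label_val :: "'m list \<Rightarrow> (nat \<Rightarrow> nat \<Rightarrow> 'm) \<Rightarrow> 'm label \<Rightarrow> 'm" where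
  "label_val x w (Obj v) = x ! v"
| "label_val x w (Arg j v) = w j v"
| "label_val x w (Elem p) = p"

text \<open>In the last conclusion \<open>W\<close> may be infinite, since the value found for the
  eliminated coordinate in one instance works for all others. It must not be empty, as that value is
  extracted from an instance.\<close>

lemma eliminate_algebraic_coordinate:
  fixes M :: "('f, 'r, 'm) struct"
  assumes \<phi>: "\<phi> \<in> formulas L (Suc n + k * l)" and k: "0 < k"
    and n: "length b1 + length b2 = n"
    and alg: "c \<in> acl L M (A \<union> (set b1 \<union> set b2))"
    and Q: "Q \<subseteq> tuples (k * l) A" "\<forall>ys\<in>Q. holds M \<phi> ((b1 @ c # b2) @ ys)"
  obtains ps \<chi> where "ps \<in> lists A" "\<chi> \<in> formulas L (n + k * (l + length ps))"
    "\<And>w. params l w [0..<k] \<in> Q \<Longrightarrow>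
       holds M \<chi> ((b1 @ b2) @ params (l + length ps) (extend_params l w ps) [0..<k])"
    "\<And>W x. W \<noteq> {} \<Longrightarrow> x \<in> tuples n (carrier M) \<Longrightarrow>
       (\<And>w. w \<in> W \<Longrightarrow> holds M \<chi> (x @ params (l + length ps) (extend_params l w ps) [0..<k])) \<Longrightarrow>
       \<exists>y\<in>tuples (Suc n) (carrier M). \<forall>w\<in>W. holds M \<phi> (y @ params l w [0..<k])"
proof -
  obtain \<theta> qs where qs: "qs \<in> lists (A \<union> (set b1 \<union> set b2))" and \<theta>: "\<theta> \<in> formulas L (Suc (length qs))"
    and c: "c \<in> carrier M" "holds M \<theta> (c # qs)" and fin: "finite {c \<in> carrier M. holds M \<theta> (c # qs)}"
    using alg unfolding acl_def by auto
  define sol where "sol Q0 = {c \<in> carrier M. holds M \<theta> (c # qs) \<and>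
    (\<forall>ys\<in>Q0. holds M \<phi> ((b1 @ c # b2) @ ys))}" for Q0
  have fin_sol: "finite (sol Q0)" for Q0
    by (rule finite_subset[OF _ fin]) (auto simp: sol_def)
  obtain Q0 where Q0: "Q0 \<subseteq> Q" "finite Q0"
    and least: "\<And>Q'. Q' \<subseteq> Q \<Longrightarrow> finite Q' \<Longrightarrow> card (sol Q0) \<le> card (sol Q')"
    using ex_has_least_nat[of "\<lambda>Q'. Q' \<subseteq> Q \<and> finite Q'" "{}" "\<lambda>Q'. card (sol Q')"] by auto
  have all: "holds M \<phi> ((b1 @ d # b2) @ ys)" if "d \<in> sol Q0" "ys \<in> Q" for d ys
  proof -
    \<comment> \<open>A further instance can only shrink the finite set of solutions, and minimality
      of its cardinality forbids a proper shrinking.\<close>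
    have "sol (insert ys Q0) = sol Q0"
      using Q0 that(2) by (intro card_seteq fin_sol least) (auto simp: sol_def)
    with that(1) show ?thesis by (auto simp: sol_def)
  qed
  obtain yss where yss: "set yss = Q0" using Q0(2) finite_list by blast
  define i where "i = length b1"
  \<comment> \<open>The parameters of Psi: those of \<open>\<theta>\<close> lying in
    \<open>A\<close>, and those of the chosen instances. The parameters of \<open>\<theta>\<close>
    outside \<open>A\<close> are entries of \<open>b1\<close> or \<open>b2\<close> and turn into
    object variables.\<close>
  define ps where "ps = filter (\<lambda>q. q \<in> A) qs @ concat yss"
  define l' where "l' = l + length ps"
  \<comment> \<open>The layout of the variables of \<open>\<chi>\<close>: the objects without
    position \<open>i\<close>, then k blocks of length \<open>l'\<close>, each ending in the
    parameters. In \<open>xs\<close> the eliminated variable is put last, where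
    \<open>Exists m\<close> binds it.\<close>
  define xs0 where "xs0 = map Obj [0..<i] @ map Obj [Suc i..<Suc n] @
    params l' (extend_params l Arg (map Elem ps)) [0..<k]"
  define xs where "xs = xs0 @ [Obj i]"
  define m where "m = n + k * l'"
  have i: "i \<le> n" using n by (simp add: i_def)
  have len_xs0: "length xs0 = m" using i by (simp add: xs0_def m_def)
  have len_xs: "Suc m = length xs" by (simp add: xs_def len_xs0)
  have Obj_in: "Obj v \<in> set xs" if "v < Suc n" for v
  proof -
    have "v \<in> {0..<i} \<union> {Suc i..<Suc n} \<union> {i}" using that by auto
    then show ?thesis by (auto simp: xs_def xs0_def simp del: upt_Suc)
  qed
  have Arg_in: "Arg j v \<in> set xs" if "j < k" "v < l" for j v
  proof -
    have "extend_params l Arg (map Elem ps) j v = Arg j v"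
      using that by (simp add: extend_params_def)
    moreover have "v < l'" using that(2) by (simp add: l'_def)
    ultimately have "Arg j v \<in> set (params l' (extend_params l Arg (map Elem ps)) [0..<k])"
      using that(1) unfolding set_params mem_Collect_eq by (intro exI[of _ j] exI[of _ v]) auto
    then show ?thesis by (simp add: xs_def xs0_def)
  qed
  have Elem_in: "Elem p \<in> set xs" if "p \<in> set ps" for p
  proof -
    obtain u where "u < length ps" "ps ! u = p" using \<open>p \<in> set ps\<close> by (metis in_set_conv_nth)
    \<comment> \<open>Block 0 contains all parameters, and it exists because k > 0.\<close>
    then have "extend_params l Arg (map Elem ps) 0 (l + u) = Elem p" "l + u < l'"
      by (simp_all add: extend_params_def l'_def)
    then have "Elem p \<in> set (params l' (extend_params l Arg (map Elem ps)) [0..<k])"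
      using k by (force simp: set_params)
    then show ?thesis by (simp add: xs_def xs0_def)
  qed
  \<comment> \<open>A parameter outside \<open>A\<close> gets a position other than
    \<open>i\<close>, at which the value does not change when \<open>d\<close> is put in place of
    \<open>c\<close>.\<close>
  define qlabel where "qlabel q = (if q \<in> A then Elem q else
    Obj (SOME v. v < Suc n \<and> v \<noteq> i \<and> (\<forall>d. (b1 @ d # b2) ! v = q)))" for q
  have qlabel: "qlabel q \<in> set xs \<and> (\<forall>w d. label_val (b1 @ d # b2) w (qlabel q) = q)"
    if "q \<in> set qs" for q
  proof (cases "q \<in> A")
    case True
    then show ?thesis using that Elem_in[of q] by (simp add: qlabel_def ps_def)
  next
    case False
    then have "q \<in> set b1 \<or> q \<in> set b2" using that qs by (auto simp: lists_eq_set)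
    then have "\<exists>v. v < Suc n \<and> v \<noteq> i \<and> (\<forall>d. (b1 @ d # b2) ! v = q)"
    proof
      assume "q \<in> set b1"
      then obtain v where "v < i" "b1 ! v = q" by (auto simp: in_set_conv_nth i_def)
      then show ?thesis using i by (intro exI[of _ v]) (auto simp: nth_append i_def)
    next
      assume "q \<in> set b2"
      then obtain v where "v < length b2" "b2 ! v = q" by (auto simp: in_set_conv_nth)
      then show ?thesis using n by (intro exI[of _ "Suc i + v"]) (auto simp: nth_append i_def)
    qed
    from someI_ex[OF this] show ?thesis using False Obj_in by (simp add: qlabel_def)
  qed
  define \<Psi> where "\<Psi> = Conj (relabel xs (Obj i # map qlabel qs) \<theta>)
    (conjs (map (\<lambda>ys. relabel xs (map Obj [0..<Suc n] @ map Elem ys) \<phi>) yss))"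
  define \<phi>' where "\<phi>' = relabel xs (map Obj [0..<Suc n] @ params l Arg [0..<k]) \<phi>"
  define \<chi> where "\<chi> = Conj (Exists m \<Psi>) (Neg (Exists m (Conj \<Psi> (Neg \<phi>'))))"
  have sub1: "set (Obj i # map qlabel qs) \<subseteq> set xs"
    using qlabel Obj_in i by auto
  have sub2: "set (map Obj [0..<Suc n] @ map Elem ys) \<subseteq> set xs" if "ys \<in> set yss" for ys
    using Obj_in Elem_in that by (auto simp: ps_def)
  have sub3: "set (map Obj [0..<Suc n] @ params l Arg [0..<k]) \<subseteq> set xs"
    using Obj_in Arg_in by (auto simp: set_params)
  have len_ys: "length ys = k * l" if "ys \<in> set yss" for ys
    using that yss Q0(1) Q(1) by (auto simp: tuples_def)
  have \<phi>1: "\<phi> \<in> formulas L (length (map Obj [0..<Suc n] @ map Elem ys))" if "ys \<in> set yss" for ys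
    using \<phi> len_ys[OF that] by simp
  have \<phi>2: "\<phi> \<in> formulas L (length (map Obj [0..<Suc n] @ params l Arg [0..<k]))"
    using \<phi> by simp
  have \<theta>': "\<theta> \<in> formulas L (length (Obj i # map qlabel qs))" using \<theta> by simp
  have \<Psi>: "\<Psi> \<in> formulas L (Suc m)"
    unfolding \<Psi>_def
  proof (intro Conj_formulas relabel_formulas[OF \<theta>' sub1 len_xs] conjs_formulas)
    show "set (map (\<lambda>ys. relabel xs (map Obj [0..<Suc n] @ map Elem ys) \<phi>) yss) \<subseteq> formulas L (Suc m)"
      using relabel_formulas[OF \<phi>1 sub2 len_xs] by (auto simp del: upt_Suc)
  qed
  have \<phi>': "\<phi>' \<in> formulas L (Suc m)"
    unfolding \<phi>'_def using \<phi>2 sub3 len_xs by (intro relabel_formulas)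
  have \<Psi>\<phi>': "Conj \<Psi> (Neg \<phi>') \<in> formulas L (Suc m)"
    by (intro Conj_formulas Neg_formulas \<Psi> \<phi>')
  have \<chi>: "\<chi> \<in> formulas L m"
    unfolding \<chi>_def by (intro Conj_formulas Neg_formulas Exists_formulas \<Psi> \<Psi>\<phi>')
  have objs: "map (label_val x w) (map Obj [0..<Suc n]) = x" if "length x = Suc n" for x :: "'m list" and w
    using that by (intro nth_equalityI) (auto simp del: upt_Suc)
  have xs0: "map (label_val (x1 @ d # x2) w) xs0 = (x1 @ x2) @ params l' (extend_params l w ps) [0..<k]"
    if "length x1 = i" "length (x1 @ x2) = n" for x1 x2 d w
  proof -
    have "map (label_val (x1 @ d # x2) w) (map Obj [0..<i]) = x1"
      using that by (intro nth_equalityI) (auto simp: nth_append)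
    moreover have "map (label_val (x1 @ d # x2) w) (map Obj [Suc i..<Suc n]) = x2"
      using that by (intro nth_equalityI) (auto simp: nth_append simp del: upt_Suc)
    moreover have "map (label_val (x1 @ d # x2) w) (params l' (extend_params l Arg (map Elem ps)) [0..<k]) =
        params l' (extend_params l w ps) [0..<k]"
      unfolding map_params by (rule params_cong) (auto simp: extend_params_def l'_def)
    ultimately show ?thesis by (simp only: xs0_def map_append append_assoc)
  qed
  \<comment> \<open>\<open>P\<close> is the meaning of \<open>\<Psi>\<close>. The filler
    \<open>\<lambda>_ _. d\<close> is arbitrary because \<open>qlabel\<close> never yields an
    \<open>Arg\<close>; hence \<open>P\<close> does not depend on the arguments
    \<open>w\<close>.\<close>
  define P where "P x1 x2 d \<longleftrightarrow> holds M \<theta> (d # map (label_val (x1 @ d # x2) (\<lambda>_ _. d)) (map qlabel qs)) \<and>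
    (\<forall>ys\<in>set yss. holds M \<phi> ((x1 @ d # x2) @ ys))" for x1 x2 d
  have no_Arg: "label_val x w (qlabel q) = label_val x w' (qlabel q)" for x w w' q
    by (simp add: qlabel_def)
  have holds_\<chi>: "holds M \<chi> ((x1 @ x2) @ params l' (extend_params l w ps) [0..<k]) \<longleftrightarrow>
      (\<exists>d\<in>carrier M. P x1 x2 d) \<and>
      (\<forall>d\<in>carrier M. P x1 x2 d \<longrightarrow> holds M \<phi> ((x1 @ d # x2) @ params l w [0..<k]))"
    if len: "length x1 = i" "length (x1 @ x2) = n" for x1 x2 w
  proof -
    let ?us = "(x1 @ x2) @ params l' (extend_params l w ps) [0..<k]"
    have len': "length (x1 @ d # x2) = Suc n" for d using len by simp
    have nth_i: "(x1 @ d # x2) ! i = d" for d using len(1) by (metis nth_append_length)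
    have us: "?us @ [d] = map (label_val (x1 @ d # x2) w) xs" for d
      using xs0[OF len, of d w] nth_i by (simp add: xs_def)
    have "holds M \<Psi> (?us @ [d]) \<longleftrightarrow> P x1 x2 d" for d
    proof -
      have "holds M (relabel xs (Obj i # map qlabel qs) \<theta>) (?us @ [d]) \<longleftrightarrow>
          holds M \<theta> (d # map (label_val (x1 @ d # x2) (\<lambda>_ _. d)) (map qlabel qs))"
        unfolding us holds_relabel[OF \<theta>' sub1] using nth_i no_Arg[of "x1 @ d # x2" w _ "\<lambda>_ _. d"]
        by (simp add: comp_def)
      moreover have "holds M (relabel xs (map Obj [0..<Suc n] @ map Elem ys) \<phi>) (?us @ [d]) \<longleftrightarrow>
          holds M \<phi> ((x1 @ d # x2) @ ys)" if "ys \<in> set yss" for ys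
        unfolding us holds_relabel[OF \<phi>1[OF that] sub2[OF that]] map_append objs[OF len']
        by (simp add: comp_def)
      ultimately show ?thesis by (simp add: \<Psi>_def holds_conjs P_def)
    qed
    moreover have "holds M \<phi>' (?us @ [d]) \<longleftrightarrow> holds M \<phi> ((x1 @ d # x2) @ params l w [0..<k])" for d
      unfolding us \<phi>'_def holds_relabel[OF \<phi>2 sub3] map_append objs[OF len']
      by (simp add: map_params)
    moreover have "length ?us = m" using len by (simp add: m_def)
    ultimately show ?thesis
      by (simp only: \<chi>_def holds_Conj holds_Neg holds_Exists[OF \<Psi>] holds_Exists[OF \<Psi>\<phi>']) blast
  qed
  have P_b: "P b1 b2 d \<longleftrightarrow> d \<in> sol Q0" if "d \<in> carrier M" for d
  proof -
    have "map (label_val (b1 @ d # b2) (\<lambda>_ _. d)) (map qlabel qs) = qs"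
      using qlabel by (simp add: map_idI)
    then show ?thesis using that by (simp add: P_def sol_def yss)
  qed
  have c_sol: "c \<in> sol Q0" using c Q(2) Q0(1) by (auto simp: sol_def)
  have "ps \<in> lists A"
    using Q0(1) Q(1) by (fastforce simp: ps_def yss tuples_def)
  have \<chi>_b: "holds M \<chi> ((b1 @ b2) @ params l' (extend_params l w ps) [0..<k])"
    if "params l w [0..<k] \<in> Q" for w
    using n c_sol c(1) all[OF _ that] P_b by (subst holds_\<chi>) (auto simp: i_def)
  have \<chi>_W: "\<exists>y\<in>tuples (Suc n) (carrier M). \<forall>w\<in>W. holds M \<phi> (y @ params l w [0..<k])"
    if W: "W \<noteq> {}" and x: "x \<in> tuples n (carrier M)"
      and \<chi>W: "\<And>w. w \<in> W \<Longrightarrow> holds M \<chi> (x @ params l' (extend_params l w ps) [0..<k])" for W x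
  proof -
    have len: "length (take i x) = i" "length (take i x @ drop i x) = n"
      using x i by (auto simp: tuples_def)
    have *: "(\<exists>d\<in>carrier M. P (take i x) (drop i x) d) \<and> (\<forall>d\<in>carrier M. P (take i x) (drop i x) d \<longrightarrow>
        holds M \<phi> ((take i x @ d # drop i x) @ params l w [0..<k]))" if "w \<in> W" for w
      using \<chi>W[OF that] holds_\<chi>[OF len, of w] by simp
    then obtain d where d: "d \<in> carrier M" "P (take i x) (drop i x) d" using W by blast
    then have "take i x @ d # drop i x \<in> tuples (Suc n) (carrier M)"
      using x len by (auto simp: tuples_def lists_eq_set dest: in_set_takeD in_set_dropD)
    then show ?thesis using * d by blast
  qed
  show thesis
  proof (rule that[of ps \<chi>])
    show "ps \<in> lists A" by fact
    show "\<chi> \<in> formulas L (n + k * (l + length ps))" using \<chi> by (simp add: m_def l'_def)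
  qed (fact \<chi>_b[unfolded l'_def], fact \<chi>_W[unfolded l'_def])
qed

section \<open>Descent on the number of variables\<close>

lemma eval_tm_embedding:
  assumes "embedding L M N h" "is_structure L M"
  shows "wf_tm L t \<Longrightarrow> (\<And>i. i \<in> fv_tm t \<Longrightarrow> e i \<in> carrier M \<and> e' i = h (e i)) \<Longrightarrow>
    eval_tm M e t \<in> carrier M \<and> eval_tm N e' t = h (eval_tm M e t)"
proof (induction t)
  case (App f ts)
  have ts: "map (eval_tm N e') ts = map h (map (eval_tm M e) ts)"
    and in_M: "map (eval_tm M e) ts \<in> lists (carrier M)"
    using App by (fastforce intro: in_listsI)+
  then show ?case
    using assms App.prems(1)
    by (simp add: embedding_def is_structure_def tuples_def del: map_map lists_eq_set in_listsI)
qed simp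

lemma sat_embedding:
  assumes "embedding L M N h" "is_structure L M"
  shows "wf_fm L \<phi> \<Longrightarrow> qfree \<phi> \<Longrightarrow> (\<And>i. i \<in> fv \<phi> \<Longrightarrow> e i \<in> carrier M \<and> e' i = h (e i)) \<Longrightarrow>
    sat N e' \<phi> \<longleftrightarrow> sat M e \<phi>"
proof (induction \<phi>)
  case (Equal s t)
  have "eval_tm M e s \<in> carrier M \<and> eval_tm N e' s = h (eval_tm M e s)"
    "eval_tm M e t \<in> carrier M \<and> eval_tm N e' t = h (eval_tm M e t)"
    using Equal by (auto intro!: eval_tm_embedding[OF assms])
  moreover have "inj_on h (carrier M)" using assms(1) by (simp add: embedding_def)
  ultimately show ?case by (simp add: inj_on_eq_iff)
next
  case (Atom r ts)
  have *: "eval_tm M e t \<in> carrier M \<and> eval_tm N e' t = h (eval_tm M e t)" if "t \<in> set ts" for t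
    using Atom that by (intro eval_tm_embedding[OF assms]) auto
  then have "map (eval_tm N e') ts = map h (map (eval_tm M e) ts)"
    and "map (eval_tm M e) ts \<in> lists (carrier M)" by auto
  then show ?case
    using assms(1) Atom.prems(1)
    by (simp add: embedding_def tuples_def del: map_map lists_eq_set in_listsI)
qed auto

lemma sim_embedding:
  assumes "embedding L M M f" "is_structure L M" "\<eta> \<in> lists (carrier M)"
  shows "sim L M \<eta> (map f \<eta>)"
proof -
  have "holds M \<phi> (map f \<eta>) \<longleftrightarrow> holds M \<phi> \<eta>" if "\<phi> \<in> formulas L (length \<eta>)" "qfree \<phi>" for \<phi>
    unfolding holds_def using that assms(3)
    by (intro sat_embedding[OF assms(1,2)]) (auto simp: formulas_def lists_eq_set subset_iff)
  then show ?thesis by (auto simp: sim_def qftp_def)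
qed

lemma sim_sym: "sim L M \<eta> \<nu> \<Longrightarrow> sim L M \<nu> \<eta>"
  and sim_trans: "sim L M \<eta> \<nu> \<Longrightarrow> sim L M \<nu> \<xi> \<Longrightarrow> sim L M \<eta> \<xi>"
  by (auto simp: sim_def)

text \<open>Over the empty set the lists of parameters are empty, so equality of the types of whole
  families reduces to \<open>same_type\<close> for finite lists of coordinates.\<close>

lemma indiscernible_iff_same_type:
  "indiscernible Lst I L M {} V a \<longleftrightarrow> indexed_in I M V a \<and>
    (\<forall>\<eta>\<in>lists (carrier I). \<forall>\<nu>\<in>lists (carrier I). sim Lst I \<eta> \<nu> \<longrightarrow>
      (\<forall>ds\<in>lists ({..<length \<eta>} \<times> V). same_type L M M (map (cat a \<eta>) ds) (map (cat a \<nu>) ds)))"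
proof -
  have "tp L M {} D c = tp L M {} D c' \<longleftrightarrow>
      (\<forall>ds\<in>lists D. same_type L M M (map c ds) (map c' ds))" for D :: "(nat \<times> 'v) set" and c c'
  proof (intro iffI ballI)
    fix ds assume eq: "tp L M {} D c = tp L M {} D c'" and ds: "ds \<in> lists D"
    have "holds M \<psi> (map c ds) \<longleftrightarrow> holds M \<psi> (map c' ds)" if "\<psi> \<in> formulas L (length ds)" for \<psi>
    proof -
      have "(\<psi>, ds, []) \<in> tp L M {} D c \<longleftrightarrow> (\<psi>, ds, []) \<in> tp L M {} D c'" using eq by simp
      then show ?thesis using that ds by (simp add: tp_def)
    qed
    then show "same_type L M M (map c ds) (map c' ds)" by (simp add: same_type_def)
  next
    assume eq: "\<forall>ds\<in>lists D. same_type L M M (map c ds) (map c' ds)"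
    then have "holds M \<psi> (map c ds) \<longleftrightarrow> holds M \<psi> (map c' ds)"
      if "ds \<in> lists D" "\<psi> \<in> formulas L (length ds)" for ds \<psi>
      using that unfolding same_type_def by (metis length_map)
    then show "tp L M {} D c = tp L M {} D c'"
      unfolding tp_def by (auto simp: lists_eq_set)
  qed
  note tp_eq = this
  have "tp L M {} ({..<length \<eta>} \<times> V) (cat a \<eta>) = tp L M {} ({..<length \<nu>} \<times> V) (cat a \<nu>) \<longleftrightarrow>
      (\<forall>ds\<in>lists ({..<length \<eta>} \<times> V). same_type L M M (map (cat a \<eta>) ds) (map (cat a \<nu>) ds))"
    if "sim Lst I \<eta> \<nu>" for \<eta> \<nu>
    using tp_eq[of "{..<length \<eta>} \<times> V" "cat a \<eta>" "cat a \<nu>"] that by (simp add: sim_def)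
  then show ?thesis
    unfolding indiscernible_def by (intro conj_cong refl ball_cong imp_cong)
qed

text \<open>\<open>params l Pair [0..<n]\<close> enumerates \<open>{..<n} \<times> {..<l}\<close> in
  the order used by \<open>params\<close>, and so links flat lists with the coordinate functions
  \<open>cat\<close>.\<close>

lemma params_conv_cat: "params l a \<eta> = map (cat a \<eta>) (params l Pair [0..<length \<eta>])"
  unfolding map_params by (subst params_conv_nth) (simp add: cat_def)

lemma params_Pair_in_lists: "params l Pair [0..<n] \<in> lists ({..<n} \<times> {..<l})"
  by (auto simp: lists_eq_set set_params)

lemma indiscernible_same_type:
  assumes "indiscernible Lst I L M {} {..<l} a" "\<eta> \<in> lists (carrier I)" "\<nu> \<in> lists (carrier I)"
    "sim Lst I \<eta> \<nu>"
  shows "same_type L M M (params l a \<eta>) (params l a \<nu>)"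
proof -
  have "length \<eta> = length \<nu>" using assms(4) by (simp add: sim_def)
  then show ?thesis
    using assms params_Pair_in_lists[of l "length \<eta>"]
    unfolding params_conv_cat[of l a \<eta>] params_conv_cat[of l a \<nu>] indiscernible_iff_same_type by auto
qed

text \<open>By means of \<open>joint\<close>, solvability of finitely many instances is a single
  formula about the concatenated parameters.\<close>

lemma realizes_iff_same_type:
  assumes "\<phi> \<in> formulas L (n + k * l)"
    "same_type L M N (params l a (concat ss)) (params l a' (concat ss'))"
    "length ss = length ss'" "\<And>\<eta>. \<eta> \<in> set ss \<Longrightarrow> length \<eta> = k" "\<And>\<eta>. \<eta> \<in> set ss' \<Longrightarrow> length \<eta> = k"
  shows "(\<exists>b\<in>tuples n (carrier M). realizes M \<phi> l a (set ss) b) \<longleftrightarrow>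
    (\<exists>b\<in>tuples n (carrier N). realizes N \<phi> l a' (set ss') b)"
proof -
  have "(\<exists>b\<in>tuples n (carrier M). \<forall>ys\<in>set (map (params l a) ss). holds M \<phi> (b @ ys)) \<longleftrightarrow>
      (\<exists>b\<in>tuples n (carrier N). \<forall>ys\<in>set (map (params l a') ss'). holds N \<phi> (b @ ys))"
    by (rule same_type_joint[OF assms(1) assms(2)[unfolded params_concat]])
      (use assms(3-5) in auto)
  then show ?thesis by (simp add: realizes_def)
qed

lemma realizes_sim:
  assumes "\<phi> \<in> formulas L (n + k * l)" "indiscernible Lst I L M {} {..<l} a"
    "sim Lst I (concat ss) (concat ss')" "length ss = length ss'"
    "set ss \<subseteq> tuples k (carrier I)" "set ss' \<subseteq> tuples k (carrier I)"
  shows "(\<exists>b\<in>tuples n (carrier M). realizes M \<phi> l a (set ss) b) \<longleftrightarrow>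
    (\<exists>b\<in>tuples n (carrier M). realizes M \<phi> l a (set ss') b)"
proof (rule realizes_iff_same_type[OF assms(1) indiscernible_same_type[OF assms(2) _ _ assms(3)] assms(4)])
  show "concat ss \<in> lists (carrier I)" "concat ss' \<in> lists (carrier I)"
    using assms(5,6) by (fastforce simp: tuples_def)+
qed (use assms(5,6) in \<open>auto simp: tuples_def\<close>)

text \<open>Consistency is finitary: a finite part of \<open>S\<close> has a copy in
  \<open>S'\<close> of the same quantifier-free type, and indiscernibility brings the solvability of
  the copy back.\<close>

lemma consistent_sim_fin:
  assumes "\<phi> \<in> formulas L (n + k * l)" "indiscernible Lst I L M {} {..<l} a"
    "S \<subseteq> tuples k (carrier I)" "S' \<subseteq> tuples k (carrier I)" "sim_fin Lst I S S'"
    "consistent M \<phi> n l a S'"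
  shows "consistent M \<phi> n l a S"
  unfolding consistent_def
proof (intro allI impI)
  fix S0 assume S0: "S0 \<subseteq> S" "finite S0"
  then obtain ss ss' where "set ss = S0" "set ss' \<subseteq> S'" "length ss = length ss'"
    "sim Lst I (concat ss) (concat ss')"
    using assms(5) unfolding sim_fin_def sim_sets_def by metis
  then show "\<exists>b\<in>tuples n (carrier M). realizes M \<phi> l a S0 b"
    using realizes_sim[OF assms(1,2), of ss ss'] assms(3,4,6) S0(1)
    by (auto simp: consistent_def)
qed

lemma sim_fin_sym: "sim_fin L M S S' \<Longrightarrow> sim_fin L M S' S"
  by (auto simp: sim_fin_def)

section \<open>The descent inside a saturated model\<close>

lemma tuples_nonempty: "A \<noteq> {} \<Longrightarrow> tuples n A \<noteq> {}"
  by (induction n) (auto simp: tuples_Suc)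

locale n_variable_setup =
  fixes Lst :: "('lf, 'lr) language" and I :: "('lf, 'lr, 'i) struct"
    and k :: nat and X :: "'i list set" and Ys :: "'i list set set"
    and L :: "('f, 'r) language" and M :: "('f, 'r, 'm) struct" and \<kappa> :: "'k rel"
  assumes I: "is_structure Lst I"
    and X: "X \<subseteq> tuples k (carrier I)" and Ys: "\<And>Y. Y \<in> Ys \<Longrightarrow> Y \<subseteq> tuples k (carrier I)"
    and cofinal: "cofinal_in k Lst I X"
    and k: "0 < k"
    and amalgam: "\<exists>W X' Y'. W \<subseteq> tuples k (carrier I) \<and> W = X' \<union> Y' \<and> X' \<inter> Y' = {} \<and>
        sim_fin Lst I X' X \<and> (\<exists>Y\<in>Ys. sim_fin Lst I Y' Y) \<and>
        (\<forall>\<nu>\<in>Y'. sim_fin Lst I ({\<nu>} \<union> X') X)"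
    and M: "is_structure L M" "sufficiently_saturated \<kappa> I L M"
begin

text \<open>\<open>witnesses\<close> in \<open>M\<close> without the demand \<open>0 < n\<close>, so
  that the descent may formally arrive at n = 0 and be refuted there.\<close>

definition pre_witness :: "('f, 'r) fm \<Rightarrow> nat \<Rightarrow> nat \<Rightarrow> ('i \<Rightarrow> nat \<Rightarrow> 'm) \<Rightarrow> bool" where
  "pre_witness \<phi> n l a \<longleftrightarrow> \<phi> \<in> formulas L (n + k * l) \<and> indiscernible Lst I L M {} {..<l} a \<and>
     consistent M \<phi> n l a X \<and> (\<forall>Y\<in>Ys. \<not> consistent M \<phi> n l a Y)"

text \<open>Without object variables, consistency of a set of instances is the truth of each one
  separately. Hence the condition on \<open>{\<nu>} \<union> X'\<close>, for one
  \<open>\<nu>\<close> at a time, settles all of \<open>Y'\<close> and thereby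
  \<open>Y\<close>.\<close>

lemma not_pre_witness_0: "\<not> pre_witness \<phi> 0 l a"
proof
  assume wit: "pre_witness \<phi> 0 l a"
  obtain X' Y' Y where sub: "X' \<union> Y' \<subseteq> tuples k (carrier I)" and Y: "Y \<in> Ys" "sim_fin Lst I Y' Y"
    and \<nu>: "\<And>\<nu>. \<nu> \<in> Y' \<Longrightarrow> sim_fin Lst I ({\<nu>} \<union> X') X"
    using amalgam by blast
  have \<phi>: "\<phi> \<in> formulas L (0 + k * l)" and a: "indiscernible Lst I L M {} {..<l} a"
    and cons: "consistent M \<phi> 0 l a X"
    using wit by (auto simp: pre_witness_def)
  have "holds M \<phi> (params l a \<nu>)" if "\<nu> \<in> Y'" for \<nu>
  proof -
    have "consistent M \<phi> 0 l a ({\<nu>} \<union> X')"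
      using sub that by (intro consistent_sim_fin[OF \<phi> a _ X \<nu> cons]) auto
    then have "\<exists>b\<in>tuples 0 (carrier M). realizes M \<phi> l a {\<nu>} b"
      unfolding consistent_def by blast
    then show ?thesis by (simp add: realizes_def)
  qed
  then have "consistent M \<phi> 0 l a Y'" by (auto simp: consistent_def realizes_def)
  then have "consistent M \<phi> 0 l a Y"
    using sub Ys[OF Y(1)] by (intro consistent_sim_fin[OF \<phi> a _ _ sim_fin_sym[OF Y(2)]]) auto
  with wit Y(1) show False by (auto simp: pre_witness_def)
qed

text \<open>All parameters lie in the image of \<open>carrier I \<times> {..<l}\<close>, a set below
  \<kappa>, so saturation turns finite satisfiability over \<open>X\<close> into one
  realization.\<close>

lemma pre_witness_realized:
  assumes "pre_witness \<phi> n l a"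
  shows "\<exists>b\<in>tuples n (carrier M). realizes M \<phi> l a X b"
proof -
  let ?A = "{a \<eta> v | \<eta> v. \<eta> \<in> carrier I \<and> v < l}"
  have \<kappa>: "Card_order \<kappa>" "natLeq <o \<kappa>" "|carrier I| <o \<kappa>" "saturated \<kappa> L M"
    using M(2) by (auto simp: sufficiently_saturated_def)
  have a: "indexed_in I M {..<l} a" using assms by (simp add: pre_witness_def indiscernible_def)
  have "?A = case_prod a ` (carrier I \<times> {..<l})" by auto
  then have "|?A| \<le>o |carrier I \<times> {..<l}|" by (metis card_of_image)
  also have "|carrier I \<times> {..<l}| <o \<kappa>"
    using \<kappa> by (intro card_of_Times_finite_ordLess) auto
  finally have small: "|?A| <o \<kappa>" .
  have "\<exists>b\<in>tuples n (carrier M). \<forall>ys\<in>params l a ` X. holds M \<phi> (b @ ys)"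
  proof (rule saturated_tuples[OF \<kappa>(4,1,2) _ small])
    show "?A \<subseteq> carrier M" using a by (auto simp: indexed_in_def)
    show "params l a ` X \<subseteq> tuples (k * l) ?A"
      using X by (fastforce simp: tuples_def set_params)
    show "\<phi> \<in> formulas L (n + k * l)" using assms by (simp add: pre_witness_def)
    fix Q0 assume "Q0 \<subseteq> params l a ` X" "finite Q0"
    then obtain X0 where "X0 \<subseteq> X" "finite X0" "Q0 = params l a ` X0"
      by (metis finite_subset_image)
    then show "\<exists>b\<in>tuples n (carrier M). \<forall>ys\<in>Q0. holds M \<phi> (b @ ys)"
      using assms by (fastforce simp: pre_witness_def consistent_def realizes_def)
  qed
  then show ?thesis by (auto simp: realizes_def)
qed

text \<open>Since \<open>k > 0\<close>, the parameters \<open>ps\<close> of the new formula can be appended to every tuple of the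
  indiscernible; a copy of \<open>I\<close> inside \<open>I\<close> whose quantifier-free types do not see the indices of \<open>ps\<close>
  keeps it indiscernible.\<close>

lemma pre_witness_descend:
  assumes wit: "pre_witness \<phi> (Suc n) l a" and n: "length b1 + length b2 = n"
    and b: "b1 @ c # b2 \<in> tuples (Suc n) (carrier M)" "realizes M \<phi> l a X (b1 @ c # b2)"
    and alg: "c \<in> acl L M ({a \<eta> v | \<eta> v. \<eta> \<in> carrier I \<and> v < l} \<union> (set b1 \<union> set b2))"
  shows "\<exists>\<phi> l a. pre_witness \<phi> n l a"
proof -
  let ?A = "{a \<eta> v | \<eta> v. \<eta> \<in> carrier I \<and> v < l}"
  have \<phi>: "\<phi> \<in> formulas L (Suc n + k * l)" and a: "indiscernible Lst I L M {} {..<l} a"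
    and incons: "\<And>Y. Y \<in> Ys \<Longrightarrow> \<not> consistent M \<phi> (Suc n) l a Y"
    using wit by (auto simp: pre_witness_def)
  have Q: "params l a ` X \<subseteq> tuples (k * l) ?A"
    using X by (fastforce simp: tuples_def set_params)
  have Q_holds: "\<forall>ys\<in>params l a ` X. holds M \<phi> ((b1 @ c # b2) @ ys)"
    using b(2) by (auto simp: realizes_def)
  obtain ps \<chi> where ps: "ps \<in> lists ?A" and \<chi>: "\<chi> \<in> formulas L (n + k * (l + length ps))"
    and \<chi>X: "\<And>w. params l w [0..<k] \<in> params l a ` X \<Longrightarrow>
       holds M \<chi> ((b1 @ b2) @ params (l + length ps) (extend_params l w ps) [0..<k])"
    and \<chi>W: "\<And>W x. W \<noteq> {} \<Longrightarrow> x \<in> tuples n (carrier M) \<Longrightarrow>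
       (\<And>w. w \<in> W \<Longrightarrow> holds M \<chi> (x @ params (l + length ps) (extend_params l w ps) [0..<k])) \<Longrightarrow>
       \<exists>y\<in>tuples (Suc n) (carrier M). \<forall>w\<in>W. holds M \<phi> (y @ params l w [0..<k])"
    by (rule eliminate_algebraic_coordinate[OF \<phi> k n alg Q Q_holds]) (rule that; blast)
  define l' where "l' = l + length ps"
  define ext where "ext = extend_params l a ps"
  have "ps \<in> lists (case_prod a ` (carrier I \<times> {..<l}))" using ps by (fastforce simp: lists_eq_set)
  then obtain ds where ds: "ds \<in> lists (carrier I \<times> {..<l})" "ps = map (case_prod a) ds"
    unfolding lists_image by blast
  \<comment> \<open>Each parameter is named in \<open>ds\<close> by an index and a coordinate; the
    indices form the finite set Z to which cofinality is applied.\<close>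
  have "fst ` set ds \<subseteq> carrier I" "finite (fst ` set ds)" using ds by (auto simp: lists_eq_set)
  from cofinal[unfolded cofinal_in_def, rule_format, OF this]
  obtain f zs where f: "embedding Lst I I f" and zs: "set zs = fst ` set ds"
    and f_sim: "\<forall>\<eta>\<in>lists (f ` carrier I). \<forall>\<nu>\<in>lists (f ` carrier I).
      sim Lst I \<eta> \<nu> \<longrightarrow> sim Lst I (\<eta> @ zs) (\<nu> @ zs)"
    and f_X: "sim_fin Lst I (tuples k (f ` carrier I) \<inter> X) X"
    by (elim exE conjE) (rule that)
  have f_carrier: "f ` carrier I \<subseteq> carrier I" using f by (simp add: embedding_def)
  have zs_carrier: "zs \<in> lists (carrier I)"
    using zs \<open>fst ` set ds \<subseteq> carrier I\<close> by (auto simp: lists_eq_set)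
  have map_f: "map f \<eta> \<in> lists (f ` carrier I)" if "\<eta> \<in> lists (carrier I)" for \<eta>
    using that by auto
  have ext_same_type: "same_type L M M (map (cat ext \<eta>) es) (map (cat ext \<nu>) es)"
    if \<eta>\<nu>: "\<eta> \<in> lists (f ` carrier I)" "\<nu> \<in> lists (f ` carrier I)" "sim Lst I \<eta> \<nu>"
      and es: "es \<in> lists ({..<length \<eta>} \<times> {..<l'})" for \<eta> \<nu> es
  proof -
    define pos where "pos z = (SOME t. t < length zs \<and> zs ! t = z)" for z
    have pos: "pos z < length zs \<and> zs ! pos z = z" if "z \<in> set zs" for z
    proof -
      have "\<exists>t. t < length zs \<and> zs ! t = z" using that by (simp add: in_set_conv_nth)
      from someI_ex[OF this] show ?thesis by (simp add: pos_def)
    qed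
    \<comment> \<open>A coordinate of \<open>ext\<close> over \<open>\<eta>\<close> is read as a
      coordinate of \<open>a\<close> over \<open>\<eta> @ zs\<close>: original entries stay in
      place, appended ones point into \<open>zs\<close>. The translation depends on
      \<open>\<eta>\<close> through its length only, so it is the same for
      \<open>\<nu>\<close>.\<close>
    define h where "h = (\<lambda>(j, v). if v < l then (j, v)
      else (length \<eta> + pos (fst (ds ! (v - l))), snd (ds ! (v - l))))"
    have ds_nth: "ds ! (v - l) \<in> set ds" if "v < l'" "\<not> v < l" for v
      using that ds(2) by (auto simp: l'_def)
    have h: "cat ext \<xi> e = cat a (\<xi> @ zs) (h e)" "h e \<in> {..<length (\<xi> @ zs)} \<times> {..<l}"
      if "length \<xi> = length \<eta>" "e \<in> {..<length \<eta>} \<times> {..<l'}" for \<xi> e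
    proof -
      obtain j v where e: "e = (j, v)" "j < length \<eta>" "v < l'" using \<open>e \<in> _\<close> by auto
      have "cat ext \<xi> e = cat a (\<xi> @ zs) (h e) \<and> h e \<in> {..<length (\<xi> @ zs)} \<times> {..<l}"
      proof (cases "v < l")
        case True
        then show ?thesis using e that(1)
          by (simp add: cat_def ext_def extend_params_def h_def nth_append)
      next
        case False
        let ?d = "ds ! (v - l)"
        have "?d \<in> set ds" using ds_nth e(3) False by blast
        then have "fst ?d \<in> set zs" "snd ?d < l" using zs ds(1) by (auto simp: lists_eq_set)
        moreover have "ext (\<xi> ! j) v = a (fst ?d) (snd ?d)"
          using False e(3) ds(2) by (simp add: ext_def extend_params_def l'_def case_prod_unfold)
        ultimately show ?thesis
          using False e that(1) pos[of "fst ?d"] by (simp add: cat_def h_def nth_append)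
      qed
      then show "cat ext \<xi> e = cat a (\<xi> @ zs) (h e)" "h e \<in> {..<length (\<xi> @ zs)} \<times> {..<l}" by auto
    qed
    have len: "length \<nu> = length \<eta>" using \<eta>\<nu>(3) by (simp add: sim_def)
    have eqs: "map (cat ext \<eta>) es = map (cat a (\<eta> @ zs)) (map h es)"
      "map (cat ext \<nu>) es = map (cat a (\<nu> @ zs)) (map h es)"
      using h(1)[OF refl] h(1)[OF len] es by (auto simp: lists_eq_set)
    have "map h es \<in> lists ({..<length (\<eta> @ zs)} \<times> {..<l})"
      using h(2)[OF refl] es by (fastforce simp: lists_eq_set)
    moreover have "\<eta> @ zs \<in> lists (carrier I)" "\<nu> @ zs \<in> lists (carrier I)"
      using \<eta>\<nu>(1,2) f_carrier zs_carrier by (auto simp: lists_eq_set)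
    ultimately show ?thesis
      using a \<eta>\<nu> f_sim unfolding eqs indiscernible_iff_same_type by blast
  qed
  define a' where "a' = (\<lambda>\<eta>. ext (f \<eta>))"
  have a'_f: "params l' a' \<eta> = params l' ext (map f \<eta>)" for \<eta>
    by (simp add: params_map a'_def)
  have indisc: "indiscernible Lst I L M {} {..<l'} a'"
    unfolding indiscernible_iff_same_type
  proof (intro conjI ballI impI)
    have "ext \<eta> v \<in> carrier M" if "\<eta> \<in> carrier I" "v < l'" for \<eta> v
    proof -
      have "indexed_in I M {..<l} a" using a by (simp add: indiscernible_def)
      then have "?A \<subseteq> carrier M" and "v < l \<Longrightarrow> a \<eta> v \<in> carrier M"
        using that by (auto simp: indexed_in_def)
      moreover have "\<not> v < l \<Longrightarrow> ps ! (v - l) \<in> set ps" using that by (auto simp: l'_def)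
      moreover have "set ps \<subseteq> ?A" using ps by (auto simp: lists_eq_set)
      ultimately show ?thesis
        by (cases "v < l") (simp_all add: ext_def extend_params_def subset_iff)
    qed
    then show "indexed_in I M {..<l'} a'"
      using f_carrier by (auto simp: indexed_in_def a'_def)
    fix \<eta> \<nu> es
    assume \<eta>\<nu>: "\<eta> \<in> lists (carrier I)" "\<nu> \<in> lists (carrier I)" "sim Lst I \<eta> \<nu>"
      and es: "es \<in> lists ({..<length \<eta>} \<times> {..<l'})"
    have "sim Lst I (map f \<eta>) (map f \<nu>)"
      using \<eta>\<nu> sim_embedding[OF f I] sim_trans sim_sym by metis
    then have "same_type L M M (map (cat ext (map f \<eta>)) es) (map (cat ext (map f \<nu>)) es)"
      using \<eta>\<nu> es map_f by (intro ext_same_type) auto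
    moreover have cat_f: "map (cat ext (map f \<xi>)) es = map (cat a' \<xi>) es" if "length \<xi> = length \<eta>" for \<xi>
      using es that by (auto simp: lists_eq_set cat_def a'_def)
    moreover have "length \<nu> = length \<eta>" using \<eta>\<nu>(3) by (simp add: sim_def)
    ultimately show "same_type L M M (map (cat a' \<eta>) es) (map (cat a' \<nu>) es)"
      by (simp only: cat_f)
  qed
  have cons: "consistent M \<chi> n l' a' X"
    unfolding consistent_def
  proof (intro allI impI)
    fix S0 assume S0: "S0 \<subseteq> X" "finite S0"
    \<comment> \<open>\<open>b1 @ b2\<close> is known to satisfy \<open>\<chi>\<close> only at
      members of \<open>X\<close>, and f need not map \<open>X\<close> into itself. The finite part
      is therefore copied into f(I) \<inter> X in the sense of k-tuples; both the copy and the
      f-image lie over f(I), where \<open>ext\<close> is indiscernible.\<close>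
    then obtain ss ss' where ss: "set ss = S0" "length ss = length ss'"
      "sim Lst I (concat ss) (concat ss')" and ss': "set ss' \<subseteq> tuples k (f ` carrier I) \<inter> X"
      using f_X unfolding sim_fin_def sim_sets_def by metis
    have ss_tuples: "set ss \<subseteq> tuples k (carrier I)" using ss(1) S0(1) X by blast
    then have ss_carrier: "concat ss \<in> lists (carrier I)" by (fastforce simp: tuples_def)
    have "concat ss' \<in> lists (f ` carrier I)" using ss' by (fastforce simp: tuples_def)
    moreover have "sim Lst I (map f (concat ss)) (concat ss')"
      using sim_embedding[OF f I ss_carrier] ss(3) sim_sym sim_trans by blast
    ultimately have "same_type L M M (map (cat ext (map f (concat ss))) (params l' Pair [0..<length (concat ss)]))
        (map (cat ext (concat ss')) (params l' Pair [0..<length (concat ss)]))"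
      using map_f[OF ss_carrier] by (intro ext_same_type) (auto simp: params_Pair_in_lists)
    moreover have "length (concat ss) = length (concat ss')" using ss(3) by (simp add: sim_def)
    ultimately have "same_type L M M (params l' a' (concat ss)) (params l' ext (concat ss'))"
      unfolding a'_f params_conv_cat[of l' ext "map f (concat ss)"] params_conv_cat[of l' ext "concat ss'"]
      by simp
    moreover have "realizes M \<chi> l' ext (set ss') (b1 @ b2)"
      unfolding realizes_def
    proof
      fix \<eta> assume "\<eta> \<in> set ss'"
      then have \<eta>: "\<eta> \<in> X" "length \<eta> = k" using ss' by (auto simp: tuples_def)
      have "params l a \<eta> = params l (\<lambda>j. a (\<eta> ! j)) [0..<k]"
        using \<eta>(2) params_conv_nth by metis
      then have "holds M \<chi> ((b1 @ b2) @ params l' (extend_params l (\<lambda>j. a (\<eta> ! j)) ps) [0..<k])"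
        unfolding l'_def using \<eta>(1) by (intro \<chi>X) (metis imageI)
      moreover have "params l' ext \<eta> = params l' (extend_params l (\<lambda>j. a (\<eta> ! j)) ps) [0..<k]"
        by (subst params_conv_nth) (simp add: \<eta>(2) ext_def extend_params_def)
      ultimately show "holds M \<chi> ((b1 @ b2) @ params l' ext \<eta>)" by simp
    qed
    moreover have "b1 @ b2 \<in> tuples n (carrier M)" using b(1) by (auto simp: tuples_def)
    moreover have "\<And>\<eta>. \<eta> \<in> set ss \<Longrightarrow> length \<eta> = k" "\<And>\<eta>. \<eta> \<in> set ss' \<Longrightarrow> length \<eta> = k"
      using ss_tuples ss' by (auto simp: tuples_def)
    ultimately show "\<exists>b\<in>tuples n (carrier M). realizes M \<chi> l' a' S0 b"
      using realizes_iff_same_type[OF \<chi>[folded l'_def] _ ss(2), of M M a' ext]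
      unfolding ss(1) by blast
  qed
  have "consistent M \<phi> (Suc n) l a Y" if Y: "Y \<in> Ys" and cons_Y: "consistent M \<chi> n l' a' Y" for Y
    unfolding consistent_def
  proof (intro allI impI)
    fix S0 assume S0: "S0 \<subseteq> Y" "finite S0"
    have S0_tuples: "S0 \<subseteq> tuples k (carrier I)" using S0(1) Ys[OF Y] by blast
    show "\<exists>b\<in>tuples (Suc n) (carrier M). realizes M \<phi> l a S0 b"
    \<comment> \<open>The empty part is separate because the lost coordinate can be recovered only
      from an instance.\<close>
    proof (cases "S0 = {}")
      case True
      then show ?thesis
        using tuples_nonempty[of "carrier M" "Suc n"] M(1) by (auto simp: realizes_def is_structure_def)
    next
      case False
      obtain x where x: "x \<in> tuples n (carrier M)" "realizes M \<chi> l' a' S0 x"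
        using cons_Y S0 unfolding consistent_def by blast
      have "holds M \<chi> (x @ params l' (extend_params l (\<lambda>j. a (f (\<eta> ! j))) ps) [0..<k])"
        if "\<eta> \<in> S0" for \<eta>
      proof -
        have "length \<eta> = k" using S0_tuples that by (auto simp: tuples_def)
        then have "params l' a' \<eta> = params l' (extend_params l (\<lambda>j. a (f (\<eta> ! j))) ps) [0..<k]"
          by (subst params_conv_nth) (simp add: a'_def ext_def extend_params_def)
        then show ?thesis using x(2) that unfolding realizes_def by metis
      qed
      then have "\<exists>y\<in>tuples (Suc n) (carrier M). \<forall>w\<in>(\<lambda>\<eta> j. a (f (\<eta> ! j))) ` S0.
          holds M \<phi> (y @ params l w [0..<k])"
        using False x(1) by (intro \<chi>W) (auto simp: l'_def)
      then obtain y where y: "y \<in> tuples (Suc n) (carrier M)"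
        "\<And>\<eta>. \<eta> \<in> S0 \<Longrightarrow> holds M \<phi> (y @ params l (\<lambda>j. a (f (\<eta> ! j))) [0..<k])" by auto
      obtain ss where ss: "set ss = S0" using S0(2) finite_list by blast
      have ss_carrier: "concat ss \<in> lists (carrier I)"
        using ss S0_tuples by (fastforce simp: tuples_def)
      \<comment> \<open>\<open>y\<close> solves the instances at the f-image of \<open>S0\<close>;
        since f preserves quantifier-free types, indiscernibility of \<open>a\<close> gives a
        solution at \<open>S0\<close> itself.\<close>
      have "realizes M \<phi> l a (set (map (map f) ss)) y"
        unfolding realizes_def
      proof
        fix \<nu> assume "\<nu> \<in> set (map (map f) ss)"
        then obtain \<eta> where \<eta>: "\<eta> \<in> S0" "\<nu> = map f \<eta>" using ss by auto
        then have "length \<eta> = k" using S0_tuples by (auto simp: tuples_def)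
        then have "params l a \<nu> = params l (\<lambda>j. a (f (\<eta> ! j))) [0..<k]"
          unfolding \<eta>(2) params_map by (subst params_conv_nth) simp
        with y(2)[OF \<eta>(1)] show "holds M \<phi> (y @ params l a \<nu>)" by simp
      qed
      moreover have "sim Lst I (concat ss) (concat (map (map f) ss))"
        using sim_embedding[OF f I ss_carrier] by (simp add: map_concat)
      moreover have "set (map (map f) ss) \<subseteq> tuples k (carrier I)"
        using ss S0_tuples f_carrier by (fastforce simp: tuples_def)
      ultimately show ?thesis
        using realizes_sim[OF \<phi> a, of ss "map (map f) ss"] y(1) ss S0_tuples by auto
    qed
  qed
  then have "pre_witness \<chi> n l' a'"
    using \<chi> indisc cons incons by (auto simp: pre_witness_def l'_def)
  then show ?thesis by blast
qed

text \<open>The formula, \<open>l\<close> and \<open>a\<close> all change when n drops, so each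
  round takes a new realization and tests independence over the current indiscernible. A dependent
  coordinate triggers the descent; otherwise the dimension is full.\<close>

lemma pre_witness_independent:
  "pre_witness \<phi> n l a \<Longrightarrow> \<exists>\<phi> n l a. 0 < n \<and> pre_witness \<phi> n l a \<and>
     (\<exists>b\<in>tuples n (carrier M). realizes M \<phi> l a X b \<and>
        alg_dim L M b {a \<eta> v | \<eta> v. \<eta> \<in> carrier I \<and> v < l} = n)"
proof (induction n arbitrary: \<phi> l a)
  case 0
  then show ?case using not_pre_witness_0 by blast
next
  case (Suc n)
  let ?A = "{a \<eta> v | \<eta> v. \<eta> \<in> carrier I \<and> v < l}"
  obtain b where b: "b \<in> tuples (Suc n) (carrier M)" "realizes M \<phi> l a X b"
    using pre_witness_realized[OF Suc.prems] by blast
  show ?case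
  proof (cases "\<exists>i<Suc n. b ! i \<in> acl L M (?A \<union> (set (take i b) \<union> set (drop (Suc i) b)))")
    case True
    then obtain i where i: "i < Suc n"
      "b ! i \<in> acl L M (?A \<union> (set (take i b) \<union> set (drop (Suc i) b)))" by blast
    have len: "length b = Suc n" using b(1) by (simp add: tuples_def)
    then have eq: "take i b @ b ! i # drop (Suc i) b = b" using i(1) by (simp add: id_take_nth_drop[symmetric])
    have "\<exists>\<phi> l a. pre_witness \<phi> n l a"
      using i len b eq by (intro pre_witness_descend[OF Suc.prems, of "take i b" "drop (Suc i) b" "b ! i"]) auto
    then show ?thesis using Suc.IH by blast
  next
    case False
    then have "alg_dim L M b ?A = Suc n" by (intro alg_dim_eq_length[OF b(1)]) blast
    then show ?thesis using Suc.prems b by blast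
  qed
qed

end

text \<open>A copy of the family \<open>a\<close> with the same type is found in \<open>M\<close>.
  Indiscernibility and consistency depend on finite subfamilies only through their types, so the
  copy is again a witness with the same formula.\<close>

lemma witnesses_transfer:
  fixes M :: "('f, 'r, 'm) struct" and N :: "('f, 'r, 'n) struct"
  assumes "complete_theory L T" "is_structure L M" "models M T" "is_structure L N" "models N T"
    and sat: "sufficiently_saturated \<kappa> I L M"
    and X: "X \<subseteq> tuples k (carrier I)" and Ys: "\<And>Y. Y \<in> Ys \<Longrightarrow> Y \<subseteq> tuples k (carrier I)"
    and wit: "witnesses Lst I k X Ys L N \<phi> n l a"
  shows "\<exists>a'. witnesses Lst I k X Ys L M \<phi> n l a'"
proof -
  have \<kappa>: "Card_order \<kappa>" "natLeq <o \<kappa>" "|carrier I| <o \<kappa>" "saturated \<kappa> L M"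
    using sat by (auto simp: sufficiently_saturated_def)
  have \<phi>: "\<phi> \<in> formulas L (n + k * l)" and a: "indiscernible Lst I L N {} {..<l} a"
    using wit by (auto simp: witnesses_def)
  have "|carrier I \<times> {..<l}| <o \<kappa>"
    using \<kappa> by (intro card_of_Times_finite_ordLess) auto
  moreover have "case_prod a ` (carrier I \<times> {..<l}) \<subseteq> carrier N"
    using a by (auto simp: indiscernible_def indexed_in_def)
  ultimately obtain a0 where a0: "a0 ` (carrier I \<times> {..<l}) \<subseteq> carrier M"
    "\<And>ds. ds \<in> lists (carrier I \<times> {..<l}) \<Longrightarrow> same_type L N M (map (case_prod a) ds) (map a0 ds)"
    using same_type_realized[OF \<kappa>(4) _ _ complete_theory_elementarily_equivalent[OF assms(1,4,5,2,3)]]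
    by metis
  define a' where "a' = curry a0"
  have cat: "same_type L N M (map (cat a \<eta>) ds) (map (cat a' \<eta>) ds)"
    if "\<eta> \<in> lists (carrier I)" "ds \<in> lists ({..<length \<eta>} \<times> {..<l})" for \<eta> ds
  proof -
    have "map (\<lambda>(j, v). (\<eta> ! j, v)) ds \<in> lists (carrier I \<times> {..<l})"
      using that by (fastforce simp: lists_eq_set)
    from a0(2)[OF this] show ?thesis by (simp add: cat_def a'_def case_prod_unfold comp_def)
  qed
  have "indiscernible Lst I L M {} {..<l} a'"
    unfolding indiscernible_iff_same_type
  proof (intro conjI ballI impI)
    show "indexed_in I M {..<l} a'" using a0(1) by (auto simp: indexed_in_def a'_def)
    fix \<eta> \<nu> ds
    assume \<eta>\<nu>: "\<eta> \<in> lists (carrier I)" "\<nu> \<in> lists (carrier I)" "sim Lst I \<eta> \<nu>"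
      and ds: "ds \<in> lists ({..<length \<eta>} \<times> {..<l})"
    then have "same_type L N N (map (cat a \<eta>) ds) (map (cat a \<nu>) ds)"
      using a by (auto simp: indiscernible_iff_same_type)
    moreover have "length \<eta> = length \<nu>" using \<eta>\<nu>(3) by (simp add: sim_def)
    ultimately show "same_type L M M (map (cat a' \<eta>) ds) (map (cat a' \<nu>) ds)"
      using cat[OF \<eta>\<nu>(1) ds] cat[OF \<eta>\<nu>(2), of ds] ds by (simp add: same_type_def)
  qed
  moreover have "consistent M \<phi> n l a' S \<longleftrightarrow> consistent N \<phi> n l a S"
    if S: "S \<subseteq> tuples k (carrier I)" for S
  proof -
    have "(\<exists>b\<in>tuples n (carrier N). realizes N \<phi> l a S0 b) \<longleftrightarrow>
        (\<exists>b\<in>tuples n (carrier M). realizes M \<phi> l a' S0 b)" if "S0 \<subseteq> S" "finite S0" for S0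
    proof -
      obtain ss where ss: "set ss = S0" using \<open>finite S0\<close> finite_list by blast
      have tuples: "set ss \<subseteq> tuples k (carrier I)" using ss that S by blast
      then have "concat ss \<in> lists (carrier I)" by (fastforce simp: tuples_def)
      then have "same_type L N M (params l a (concat ss)) (params l a' (concat ss))"
        unfolding params_conv_cat[of l a "concat ss"] params_conv_cat[of l a' "concat ss"]
        by (intro cat params_Pair_in_lists)
      from realizes_iff_same_type[OF \<phi> this refl] show ?thesis
        using tuples unfolding ss by (auto simp: tuples_def)
    qed
    then show ?thesis unfolding consistent_def by blast
  qed
  ultimately show ?thesis using wit X Ys unfolding witnesses_def by blast
qed

theorem theorem10p29:
  fixes Lst :: "('lf, 'lr) language" and I :: "('lf, 'lr, 'i) struct"
    and k :: nat and X :: "'i list set" and Ys :: "'i list set set"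
    and L :: "('f, 'r) language" and T :: "('f, 'r) fm set"
    and M :: "('f, 'r, 'm) struct" and \<kappa> :: "'k rel"
  assumes "n_variable TYPE('f1) TYPE('r1) TYPE('m1) TYPE('v1) TYPE('k1) TYPE('c) TYPE('j)
             Lst I k X Ys"
    and "complete_theory L T"
    and "is_structure L M" and "models M T" and "sufficiently_saturated \<kappa> I L M"
    and "T \<notin> D_class TYPE('n) Lst I k X Ys L"
  shows "\<exists>\<phi> n l a. witnesses Lst I k X Ys L M \<phi> n l a \<and>
           (\<exists>b\<in>tuples n (carrier M). realizes M \<phi> l a X b \<and>
              alg_dim L M b {a \<eta> v | \<eta> v. \<eta> \<in> carrier I \<and> v < l} = n)"
proof -
  have quint: "is_structure Lst I" "X \<subseteq> tuples k (carrier I)" "\<forall>Y\<in>Ys. Y \<subseteq> tuples k (carrier I)"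
    "cofinal_in k Lst I X" and card: "\<forall>Y\<in>Ys. infinite Y \<or> card Y > 1"
    and amalgam: "\<exists>W X' Y'. W \<subseteq> tuples k (carrier I) \<and> W = X' \<union> Y' \<and> X' \<inter> Y' = {} \<and>
        sim_fin Lst I X' X \<and> (\<exists>Y\<in>Ys. sim_fin Lst I Y' Y) \<and>
        (\<forall>\<nu>\<in>Y'. sim_fin Lst I ({\<nu>} \<union> X') X)"
    using assms(1) by (simp_all add: n_variable_def Let_def)
  obtain Y where Y: "Y \<in> Ys" using amalgam by blast
  have "0 < k"
  proof (rule ccontr)
    assume "\<not> 0 < k"
    then have sub: "Y \<subseteq> {[]}" using quint(3) Y by auto
    then have "finite Y" "card Y \<le> 1" using finite_subset card_mono[OF _ sub] by auto
    then show False using card Y by auto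
  qed
  then interpret n_variable_setup Lst I k X Ys L M \<kappa>
    using quint amalgam assms(3,5) by unfold_locales blast+
  have "\<exists>(N :: ('f, 'r, 'n) struct) \<phi> n l a. is_structure L N \<and> models N T \<and>
      witnesses Lst I k X Ys L N \<phi> n l a"
    using assms(2,6) unfolding D_class_def by blast
  then obtain N :: "('f, 'r, 'n) struct" and \<phi> n l a where
    "is_structure L N" "models N T" "witnesses Lst I k X Ys L N \<phi> n l a" by blast
  then obtain a' where "witnesses Lst I k X Ys L M \<phi> n l a'"
    using witnesses_transfer[OF assms(2-4) _ _ assms(5) quint(2)] quint(3) by blast
  then have "pre_witness \<phi> n l a'" by (simp add: witnesses_def pre_witness_def)
  moreover have "witnesses Lst I k X Ys L M \<phi> n l a" if "0 < n" "pre_witness \<phi> n l a" for \<phi> n l a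
    using that by (simp add: witnesses_def pre_witness_def)
  ultimately show ?thesis using pre_witness_independent by meson
qed

end
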